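(* Let $d\ge 1$ and $\sigma\in(-d,0)$. Then the following hold. (1) ($\Gamma$-liminf inequality) For every $\rho\in L^1(\mathbb{R}^d,[0,1])$ and every family $\{\mu_\varepsilon\}_{\varepsilon\in(0,1)}\subset\mathcal{M}_b(\mathbb{R}^d)$ with $\frac{\varepsilon^d\omega_d}{C^d}\mu_\varepsilon\to\rho\,\mathcal{L}^d$ tightly in $\mathcal{M}_b(\mathbb{R}^d)$ as $\varepsilon\to0^+$, $$\mathcal{F}^\sigma(\rho\,\mathcal{L}^d)\le\liminf_{\varepsilon\to0^+}\mathcal{F}^\sigma_\varepsilon(\mu_\varepsilon).$$ (2) ($\Gamma$-limsup inequality) For every $\rho\in L^1(\mathbb{R}^d,[0,1])$ there exists a family $\{\mu_\varepsilon\}_{\varepsilon\in(0,1)}\subset\mathcal{M}_b(\mathbb{R}^d)$ such that $\frac{\varepsilon^d\omega_d}{C^d}\mu_\varepsilon\to\rho\,\mathcal{L}^d$ tightly in $\mathcal{M}_b(\mathbb{R}^d)$ as $\varepsilon\to0^+$ and $$\mathcal{F}^\sigma(\rho\,\mathcal{L}^d)\ge\limsup_{\varepsilon\to0^+}\mathcal{F}^\sigma_\varepsilon(\mu_\varepsilon).$$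
   Context: $\mathcal{L}^d$ (also $|\cdot|$ on sets) is Lebesgue measure on $\mathbb{R}^d$, $\omega_d$ is the Lebesgue measure of the unit ball, $\mathcal{M}_b(\mathbb{R}^d)$ is the set of nonnegative finite Radon measures on $\mathbb{R}^d$, and $L^1(\mathbb{R}^d,[0,1])$ is the set of integrable functions with values in $[0,1]$. Optimal packing density: let $\mathrm{Ad}^d$ be the class of sets $X\subset\mathbb{R}^d$ with $|x-y|\ge2$ for all distinct $x,y\in X$, and let $Q=[0,1)^d$. Then $$C^d:=\sup_{X\in\mathrm{Ad}^d}\limsup_{r\to+\infty}\frac{\#(X\cap rQ)\,\omega_d}{|rQ|}.$$ Tight convergence $\nu_\varepsilon\to\nu$ in $\mathcal{M}_b(\mathbb{R}^d)$ means $\nu_\varepsilon\stackrel{*}{\rightharpoonup}\nu$ weakly-star and $\nu_\varepsilon(\mathbb{R}^d)\to\nu(\mathbb{R}^d)$ as $\varepsilon\to0^+$. For $\varepsilon>0$, $\mathcal{EM}_\varepsilon$ is the set of measures $\sum_{i=1}^N\delta_{x_i}$ ($N\in\mathbb{N}$, possibly $N=0$) with $|x_i-x_j|\ge2\varepsilon$ for all $i\ne j$. For $\sigma\in(-d,0)$ the discrete energy $\mathcal{F}^\sigma_\varepsilon:\mathcal{M}_b(\mathbb{R}^d)\to\mathbb{R}\cup\{\pm\infty\}$ is $$\mathcal{F}^\sigma_\varepsilon(\mu)=\sum_{i\ne j}-\frac{1}{|x_i-x_j|^{d+\sigma}}\Big(\frac{\omega_d\varepsilon^d}{C^d}\Big)^2\quad\text{if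 }\mu=\sum_{i=1}^N\delta_{x_i}\in\mathcal{EM}_\varepsilon,$$ and $\mathcal{F}^\sigma_\varepsilon(\mu)=+\infty$ otherwise. The limit energy is $$\mathcal{F}^\sigma(\mu)=\int_{\mathbb{R}^d}\int_{\mathbb{R}^d}-\frac{1}{|x-y|^{d+\sigma}}\,d\mu\otimes\mu\quad\text{if }\mu\le\mathcal{L}^d,$$ and $\mathcal{F}^\sigma(\mu)=+\infty$ otherwise. *)

theory Defs
  imports "HOL-Analysis.Analysis"
begin

text \<open>
  The space \<open>\<real>\<^sup>d\<close> is an arbitrary type \<open>'a\<close> of class \<open>euclidean_space\<close>, with \<open>d = DIM('a) \<ge> 1\<close>.
\<close>

definition omega :: "'a::euclidean_space itself \<Rightarrow> real" where
  "omega _ = measure lborel (ball (0::'a) 1)"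

definition Ad :: "'a::euclidean_space set set" where
  "Ad = {X. pairwise (\<lambda>x y. 2 \<le> dist x y) X}"

definition unit_cube :: "'a::euclidean_space set" where
  "unit_cube = {x. \<forall>b\<in>Basis. 0 \<le> x \<bullet> b \<and> x \<bullet> b < 1}"

text \<open>
  The supremum is taken in the extended reals; it lies in \<open>(0, 1]\<close>, so that \<open>real_of_ereal\<close> loses
  nothing. The sets whose cardinality is taken are bounded and 2-separated, hence finite.
\<close>

definition packing_density :: "'a::euclidean_space itself \<Rightarrow> real" where
  "packing_density _ = real_of_ereal
     (SUP X\<in>(Ad :: 'a set set).
        Limsup at_top (\<lambda>r::real.
          ereal (real (card (X \<inter> (*\<^sub>R) r ` unit_cube)) * omega TYPE('a)
                 / measure lborel ((*\<^sub>R) r ` (unit_cube :: 'a set)))))"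

text \<open>On a Euclidean space every finite Borel measure is Radon.\<close>

definition Mb :: "'a::euclidean_space measure set" where
  "Mb = {\<mu>. sets \<mu> = sets borel \<and> finite_measure \<mu>}"

text \<open>
  The elements of \<open>L\<^sup>1\<close> are represented by Borel functions, with the constraint on the values
  holding almost everywhere.
\<close>

definition L1_unit :: "('a::euclidean_space \<Rightarrow> real) set" where
  "L1_unit = {\<rho>. integrable lborel \<rho> \<and> (AE x in lborel. \<rho> x \<in> {0..1})}"

definition weak_star_tendsto ::
    "(real \<Rightarrow> 'a::euclidean_space measure) \<Rightarrow> 'a measure \<Rightarrow> bool" where
  "weak_star_tendsto \<nu> \<nu>\<^sub>0 \<longleftrightarrow>
     (\<forall>f::'a \<Rightarrow> real. continuous_on UNIV f \<longrightarrow> (f \<longlongrightarrow> 0) at_infinity \<longrightarrow>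
        ((\<lambda>\<epsilon>. \<integral>x. f x \<partial>\<nu> \<epsilon>) \<longlongrightarrow> (\<integral>x. f x \<partial>\<nu>\<^sub>0)) (at_right 0))"

definition tight_tendsto ::
    "(real \<Rightarrow> 'a::euclidean_space measure) \<Rightarrow> 'a measure \<Rightarrow> bool" where
  "tight_tendsto \<nu> \<nu>\<^sub>0 \<longleftrightarrow>
     weak_star_tendsto \<nu> \<nu>\<^sub>0 \<and>
     ((\<lambda>\<epsilon>. measure (\<nu> \<epsilon>) UNIV) \<longlongrightarrow> measure \<nu>\<^sub>0 UNIV) (at_right 0)"

text \<open>
  The sum of the Dirac masses at \<open>x 0, \<dots>, x (N - 1)\<close>, as the image of a counting measure; see
  \<open>emeasure_dirac_sum\<close> below.
\<close>

definition dirac_sum :: "nat \<Rightarrow> (nat \<Rightarrow> 'a::euclidean_space) \<Rightarrow> 'a measure" where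
  "dirac_sum N x = distr (count_space {..<N}) borel x"

definition separated :: "real \<Rightarrow> nat \<Rightarrow> (nat \<Rightarrow> 'a::euclidean_space) \<Rightarrow> bool" where
  "separated \<epsilon> N x \<longleftrightarrow> (\<forall>i<N. \<forall>j<N. i \<noteq> j \<longrightarrow> 2 * \<epsilon> \<le> dist (x i) (x j))"

definition EM :: "real \<Rightarrow> 'a::euclidean_space measure set" where
  "EM \<epsilon> = {dirac_sum N x | N x. separated \<epsilon> N x}"

definition point_energy ::
    "real \<Rightarrow> real \<Rightarrow> nat \<Rightarrow> (nat \<Rightarrow> 'a::euclidean_space) \<Rightarrow> real" where
  "point_energy \<sigma> \<epsilon> N x =
     (\<Sum>i<N. \<Sum>j\<in>{..<N} - {i}.
        - (1 / dist (x i) (x j) powr (real DIM('a) + \<sigma>))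
        * (omega TYPE('a) * \<epsilon> ^ DIM('a) / packing_density TYPE('a))\<^sup>2)"

text \<open>
  The points \<open>x 0, \<dots>, x (N - 1)\<close> are determined by the measure up to their order, so the
  description below is unique; see \<open>discrete_energy_dirac_sum\<close>.
\<close>

definition discrete_energy ::
    "real \<Rightarrow> real \<Rightarrow> 'a::euclidean_space measure \<Rightarrow> ereal" where
  "discrete_energy \<sigma> \<epsilon> \<mu> =
     (if \<mu> \<in> EM \<epsilon>
      then ereal (THE E. \<exists>N x. separated \<epsilon> N x \<and> \<mu> = dirac_sum N x \<and> E = point_energy \<sigma> \<epsilon> N x)
      else \<infinity>)"

text \<open>
  The kernel has a constant sign, so the double integral is minus a nonnegative integral. On the
  diagonal the kernel takes the value \<open>1 / 0 = 0\<close> in place of \<open>\<infinity>\<close>; the diagonal is a null set for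
  \<open>\<mu> \<Otimes>\<^sub>M \<mu>\<close> when \<open>\<mu> \<le> lborel\<close>.
\<close>

definition limit_energy :: "real \<Rightarrow> 'a::euclidean_space measure \<Rightarrow> ereal" where
  "limit_energy \<sigma> \<mu> =
     (if \<mu> \<le> lborel
      then - enn2ereal (\<integral>\<^sup>+ (x, y).
               ennreal (1 / dist x y powr (real DIM('a) + \<sigma>)) \<partial>(\<mu> \<Otimes>\<^sub>M \<mu>))
      else \<infinity>)"

definition rescaled ::
    "(real \<Rightarrow> 'a::euclidean_space measure) \<Rightarrow> real \<Rightarrow> 'a measure" where
  "rescaled \<mu> \<epsilon> =
     scale_measure (ennreal (\<epsilon> ^ DIM('a) * omega TYPE('a) / packing_density TYPE('a))) (\<mu> \<epsilon>)"

abbreviation with_density :: "('a::euclidean_space \<Rightarrow> real) \<Rightarrow> 'a measure" where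
  "with_density \<rho> \<equiv> density lborel (\<lambda>x. ennreal (\<rho> x))"

lemma emeasure_dirac_sum:
  fixes x :: "nat \<Rightarrow> 'a::euclidean_space"
  assumes "A \<in> sets borel"
  shows "emeasure (dirac_sum N x) A = (\<Sum>i<N. indicator A (x i))"
proof -
  have "emeasure (dirac_sum N x) A = (\<integral>\<^sup>+ y. indicator A y \<partial>dirac_sum N x)"
    using assms by (simp add: dirac_sum_def)
  also have "\<dots> = (\<integral>\<^sup>+ i. indicator A (x i) \<partial>count_space {..<N})"
    unfolding dirac_sum_def using assms by (subst nn_integral_distr) auto
  finally show ?thesis by (simp add: nn_integral_count_space_finite)
qed

lemma discrete_energy_dirac_sum:
  fixes x :: "nat \<Rightarrow> 'a::euclidean_space"
  assumes "0 < \<epsilon>" and "separated \<epsilon> N x"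
  shows "discrete_energy \<sigma> \<epsilon> (dirac_sum N x) = ereal (point_energy \<sigma> \<epsilon> N x)"
proof -
  define k where "k = (\<lambda>p q::'a. - (1 / dist p q powr (real DIM('a) + \<sigma>))
        * (omega TYPE('a) * \<epsilon> ^ DIM('a) / packing_density TYPE('a))\<^sup>2)"
  define S where "S = (\<lambda>M::'a measure. {p. emeasure M {p} \<noteq> 0})"
  have atoms: "S (dirac_sum M y) = y ` {..<M}" for M and y :: "nat \<Rightarrow> 'a"
    by (auto simp: S_def emeasure_dirac_sum indicator_def split: if_splits)
  have energy: "point_energy \<sigma> \<epsilon> M y =
      (\<Sum>p\<in>S (dirac_sum M y). \<Sum>q\<in>S (dirac_sum M y) - {p}. k p q)"
    if "separated \<epsilon> M y" for M and y :: "nat \<Rightarrow> 'a"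
  proof -
    have inj: "inj_on y {..<M}"
    proof (rule inj_onI, rule ccontr)
      fix i j assume "i \<in> {..<M}" "j \<in> {..<M}" "y i = y j" "i \<noteq> j"
      with that have "2 * \<epsilon> \<le> dist (y i) (y j)" unfolding separated_def by blast
      with \<open>y i = y j\<close> assms(1) show False by simp
    qed
    have diff: "y ` {..<M} - {y i} = y ` ({..<M} - {i})" if "i < M" for i
      using inj that by (auto simp: inj_on_def)
    have "(\<Sum>p\<in>y ` {..<M}. \<Sum>q\<in>y ` {..<M} - {p}. k p q) =
        (\<Sum>i<M. \<Sum>q\<in>y ` ({..<M} - {i}). k (y i) q)"
      using inj by (simp add: sum.reindex diff)
    also have "\<dots> = (\<Sum>i<M. \<Sum>j\<in>{..<M} - {i}. k (y i) (y j))"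
      by (intro sum.cong refl, subst sum.reindex) (auto intro: inj_on_subset[OF inj])
    finally show ?thesis by (simp add: atoms point_energy_def k_def)
  qed
  have "(THE E. \<exists>M y. separated \<epsilon> M y \<and> dirac_sum N x = dirac_sum M y \<and> E = point_energy \<sigma> \<epsilon> M y)
      = point_energy \<sigma> \<epsilon> N x"
  proof (rule the_equality)
    show "\<exists>M y. separated \<epsilon> M y \<and> dirac_sum N x = dirac_sum M y \<and>
        point_energy \<sigma> \<epsilon> N x = point_energy \<sigma> \<epsilon> M y"
      using assms(2) by blast
  next
    fix E
    assume "\<exists>M y. separated \<epsilon> M y \<and> dirac_sum N x = dirac_sum M y \<and> E = point_energy \<sigma> \<epsilon> M y"
    then obtain M y where My: "separated \<epsilon> M y" "dirac_sum N x = dirac_sum M y"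
      "E = point_energy \<sigma> \<epsilon> M y"
      by blast
    show "E = point_energy \<sigma> \<epsilon> N x"
      unfolding My(3) energy[OF My(1)] energy[OF assms(2)] My(2) ..
  qed
  moreover have "dirac_sum N x \<in> EM \<epsilon>"
    using assms(2) by (auto simp: EM_def)
  ultimately show ?thesis
    by (simp add: discrete_energy_def)
qed

end

theory Submission
  imports Defs
begin

text \<open>
  Write \<open>s = d + \<sigma>\<close>, so that \<open>0 < s < d\<close>, and \<open>\<nu>\<^sub>\<epsilon>\<close> for the rescaled measure, in which every atom has
  mass \<open>\<epsilon>\<^sup>d \<omega>\<^sub>d / C\<^sup>d\<close>. The discrete energy is minus the integral of \<open>|x - y|\<^bsup>-s\<^esup>\<close> against
  \<open>\<nu>\<^sub>\<epsilon> \<otimes> \<nu>\<^sub>\<epsilon>\<close> off the diagonal. The kernel is locally integrable, and this makes the energy continuous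
  along every tightly convergent family of \<open>2\<epsilon>\<close>-separated measures.

  To see this, replace \<open>|z|\<close> by \<open>max |z| r\<close> in the kernel. The truncated kernel is bounded and uniformly
  continuous, so its double integral against \<open>\<nu>\<^sub>\<epsilon> \<otimes> \<nu>\<^sub>\<epsilon>\<close> converges (\<open>tight_tendsto_double_integral\<close>).
  Truncation changes the discrete energy in two places. Pairs closer than \<open>r\<close> lose interaction: since
  the balls of radius \<open>\<epsilon>\<close> around the points are disjoint, the sum over the neighbours of one
  point, weighted with the mass of an atom, is at most a constant times the integral of \<open>|z|\<^bsup>-s\<^esup>\<close> over a ball of radius \<open>3r/2\<close>
  (\<open>sum_riesz_kernel_near\<close>), which is small with \<open>r\<close>, uniformly in \<open>\<epsilon>\<close>. The diagonal is gained: it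
  contributes one atom's mass times the total mass times \<open>r\<^bsup>-s\<^esup>\<close>, which vanishes with \<open>\<epsilon>\<close>. The first
  estimate gives the lower bound \<open>discrete_energy_liminf\<close>; the second one, with \<open>r \<rightarrow> 0\<close> and Fatou's
  lemma, gives the upper bound \<open>discrete_energy_limsup\<close>.

  What remains for the second part is to find, for every density \<open>\<rho>\<close> with values in \<open>[0,1]\<close>, separated
  measures that converge tightly to it. With the masses normalised by \<open>C\<^sup>d\<close>, the densities that packings
  can reach in the limit are those up to 1. Fix a finite packing
  of a large cube of side \<open>r\<close> whose density is almost optimal, and tile space by cubes of side
  \<open>\<epsilon>(r + 2)\<close>. Each tile has room for a copy of the packing scaled by \<open>\<epsilon>\<close>, the margin \<open>2\<epsilon>\<close> keeping
  different copies apart. Up to a small fraction, the full copy has at least the volume of the tile as its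
  rescaled mass, and \<open>\<rho>\<close> puts at most this volume there; so keeping the right number of points
  reproduces the mass of \<open>\<rho>\<close> up to a small fraction of the volume (\<open>packing_approximation\<close>). A diagonal choice over
  better and better packings yields the family (\<open>recovery_family\<close>).
\<close>

section \<open>Half-open cubes, lattices and the packing density\<close>

definition half_open_cube :: "'a::euclidean_space \<Rightarrow> real \<Rightarrow> 'a set" where
  "half_open_cube z r = {x. \<forall>b\<in>Basis. z \<bullet> b \<le> x \<bullet> b \<and> x \<bullet> b < z \<bullet> b + r}"

definition cubic_lattice :: "real \<Rightarrow> 'a::euclidean_space set" where
  "cubic_lattice l = {z. \<forall>b\<in>Basis. \<exists>k::int. z \<bullet> b = l * of_int k}"

lemma half_open_cube_borel [measurable]: "half_open_cube z r \<in> sets borel"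
proof -
  have "{x \<in> space borel. \<forall>b\<in>Basis. z \<bullet> b \<le> x \<bullet> b \<and> x \<bullet> b < z \<bullet> b + r} \<in> sets borel"
    by (intro sets.sets_Collect_finite_All) auto
  then show ?thesis by (simp add: half_open_cube_def)
qed

lemma emeasure_half_open_cube:
  fixes z :: "'a::euclidean_space"
  assumes "0 \<le> r"
  shows "emeasure lborel (half_open_cube z r) = ennreal (r ^ DIM('a))"
proof (rule antisym)
  let ?w = "z + (\<Sum>b\<in>Basis. r *\<^sub>R b)"
  have w: "?w \<bullet> b = z \<bullet> b + r" if "b \<in> Basis" for b
    using that by (simp add: inner_add_left inner_sum_left inner_Basis if_distrib cong: if_cong)
  have "emeasure lborel (half_open_cube z r) \<le> emeasure lborel (cbox z ?w)"
    by (intro emeasure_mono) (auto simp: half_open_cube_def mem_box w less_imp_le)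
  also have "\<dots> = ennreal (r ^ DIM('a))"
    using assms by (subst emeasure_lborel_cbox) (auto simp: w inner_diff_left inner_add_left)
  finally show "emeasure lborel (half_open_cube z r) \<le> ennreal (r ^ DIM('a))" .
  have "ennreal (r ^ DIM('a)) = emeasure lborel (box z ?w)"
    using assms by (subst emeasure_lborel_box) (auto simp: w inner_diff_left inner_add_left)
  also have "\<dots> \<le> emeasure lborel (half_open_cube z r)"
    by (intro emeasure_mono) (auto simp: half_open_cube_def mem_box w less_imp_le)
  finally show "ennreal (r ^ DIM('a)) \<le> emeasure lborel (half_open_cube z r)" .
qed

lemma measure_half_open_cube:
  "0 \<le> r \<Longrightarrow> measure lborel (half_open_cube (z::'a::euclidean_space) r) = r ^ DIM('a)"
  by (simp add: measure_def emeasure_half_open_cube)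

lemma scaleR_unit_cube:
  assumes "0 < r"
  shows "(*\<^sub>R) r ` unit_cube = half_open_cube (0::'a::euclidean_space) r"
proof (intro set_eqI iffI)
  fix x :: 'a assume "x \<in> half_open_cube 0 r"
  then have "(1 / r) *\<^sub>R x \<in> unit_cube"
    using assms by (auto simp: half_open_cube_def unit_cube_def field_simps)
  moreover have "x = r *\<^sub>R ((1 / r) *\<^sub>R x)" using assms by simp
  ultimately show "x \<in> (*\<^sub>R) r ` unit_cube" by blast
next
  fix x :: 'a assume "x \<in> (*\<^sub>R) r ` unit_cube"
  then show "x \<in> half_open_cube 0 r"
    using assms by (auto simp: half_open_cube_def unit_cube_def)
qed

lemma dist_half_open_cube:
  fixes x y :: "'a::euclidean_space"
  assumes "x \<in> half_open_cube z r" "y \<in> half_open_cube z r"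
  shows "dist x y \<le> real DIM('a) * r"
proof -
  have "dist x y \<le> (\<Sum>b\<in>Basis. \<bar>(x - y) \<bullet> b\<bar>)"
    unfolding dist_norm by (rule norm_le_l1)
  also have "\<dots> \<le> (\<Sum>b\<in>(Basis::'a set). r :: real)"
  proof (rule sum_mono)
    fix b :: 'a assume b: "b \<in> Basis"
    have "z \<bullet> b \<le> x \<bullet> b" "x \<bullet> b < z \<bullet> b + r" "z \<bullet> b \<le> y \<bullet> b" "y \<bullet> b < z \<bullet> b + r"
      using assms b by (auto simp: half_open_cube_def)
    then show "\<bar>(x - y) \<bullet> b\<bar> \<le> r" by (simp add: inner_diff_left abs_le_iff)
  qed
  finally show ?thesis by simp
qed

lemma half_open_cube_corner: "0 < r \<Longrightarrow> z \<in> half_open_cube z r"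
  by (simp add: half_open_cube_def)

text \<open>
  The tile containing \<open>x\<close> is found by rounding down each coordinate. The last conclusion keeps
  that corner in the positive orthant, so that the tiles meeting \<open>[0, r)\<^sup>d\<close> at all can be taken with
  corners in \<open>[0, r)\<^sup>d\<close>.
\<close>

lemma cubic_lattice_cover:
  fixes x :: "'a::euclidean_space"
  assumes "0 < l"
  obtains z where "z \<in> cubic_lattice l" "x \<in> half_open_cube z l" "\<And>b. b \<in> Basis \<Longrightarrow> 0 \<le> x \<bullet> b \<Longrightarrow> 0 \<le> z \<bullet> b"
proof
  let ?z = "\<Sum>b\<in>Basis. (l * of_int \<lfloor>x \<bullet> b / l\<rfloor>) *\<^sub>R b"
  have z: "?z \<bullet> b = l * of_int \<lfloor>x \<bullet> b / l\<rfloor>" if "b \<in> Basis" for b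
    using that by (simp add: inner_sum_left inner_Basis if_distrib cong: if_cong)
  show "?z \<in> cubic_lattice l" unfolding cubic_lattice_def using z by auto
  have "l * of_int \<lfloor>t / l\<rfloor> \<le> t \<and> t < l * of_int \<lfloor>t / l\<rfloor> + l" for t
  proof -
    have "of_int \<lfloor>t / l\<rfloor> \<le> t / l" "t / l < of_int \<lfloor>t / l\<rfloor> + 1" by linarith+
    then have "l * of_int \<lfloor>t / l\<rfloor> \<le> l * (t / l)" "l * (t / l) < l * (of_int \<lfloor>t / l\<rfloor> + 1)"
      using assms by (simp_all only: mult_le_cancel_left_pos mult_less_cancel_left_pos)
    then show ?thesis using assms by (simp add: algebra_simps)
  qed
  then show "x \<in> half_open_cube ?z l" by (auto simp: half_open_cube_def z)
  show "0 \<le> ?z \<bullet> b" if "b \<in> Basis" "0 \<le> x \<bullet> b" for b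
    using that assms by (simp add: z)
qed

lemma cubic_lattice_gap:
  fixes z z' :: "'a::euclidean_space"
  assumes "0 < l" "z \<in> cubic_lattice l" "z' \<in> cubic_lattice l" "z \<noteq> z'"
  obtains b where "b \<in> Basis" "l \<le> \<bar>z \<bullet> b - z' \<bullet> b\<bar>"
proof -
  obtain b where b: "b \<in> Basis" "z \<bullet> b \<noteq> z' \<bullet> b"
    using assms(4) euclidean_eqI by blast
  obtain k k' :: int where k: "z \<bullet> b = l * of_int k" "z' \<bullet> b = l * of_int k'"
    using assms(2,3) b(1) unfolding cubic_lattice_def by blast
  have "1 \<le> \<bar>k - k'\<bar>" using b(2) k by auto
  then have "1 \<le> \<bar>real_of_int k - real_of_int k'\<bar>" by linarith
  then have "l * 1 \<le> l * \<bar>real_of_int k - real_of_int k'\<bar>" using assms(1) by (intro mult_left_mono) auto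
  also have "\<dots> = \<bar>z \<bullet> b - z' \<bullet> b\<bar>"
    using assms(1) by (simp add: k abs_mult flip: right_diff_distrib)
  finally show ?thesis using b(1) that by simp
qed

text \<open>
  In a coordinate in which the corners differ, they differ by at least \<open>l\<close>, and a cube of side \<open>r\<close>
  uses up only \<open>r\<close> of that. With \<open>r = l\<close> this says that the tiles are disjoint; with \<open>r < l\<close> it is the
  gap between shrunken tiles.
\<close>

lemma half_open_cubes_separated:
  fixes x x' :: "'a::euclidean_space"
  assumes "0 < l" "z \<in> cubic_lattice l" "z' \<in> cubic_lattice l" "z \<noteq> z'"
    and "x \<in> half_open_cube z r" "x' \<in> half_open_cube z' r"
  shows "l - r < dist x x'"
proof -
  obtain b where b: "b \<in> Basis" "l \<le> \<bar>z \<bullet> b - z' \<bullet> b\<bar>"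
    using cubic_lattice_gap assms(1-4) by blast
  have "z \<bullet> b \<le> x \<bullet> b" "x \<bullet> b < z \<bullet> b + r" "z' \<bullet> b \<le> x' \<bullet> b" "x' \<bullet> b < z' \<bullet> b + r"
    using assms(5,6) b(1) by (auto simp: half_open_cube_def)
  then have "l - r < \<bar>(x - x') \<bullet> b\<bar>"
    using b(2) unfolding inner_diff_left by arith
  also have "\<dots> \<le> dist x x'" using b(1) by (simp add: dist_norm Basis_le_norm)
  finally show ?thesis .
qed

lemma cubic_lattice_dist:
  fixes z z' :: "'a::euclidean_space"
  assumes "0 < l" "z \<in> cubic_lattice l" "z' \<in> cubic_lattice l" "z \<noteq> z'"
  shows "l \<le> dist z z'"
proof -
  obtain b where b: "b \<in> Basis" "l \<le> \<bar>z \<bullet> b - z' \<bullet> b\<bar>"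
    using cubic_lattice_gap assms by blast
  then show ?thesis
    using Basis_le_norm[OF b(1), of "z - z'"] by (simp add: dist_norm inner_diff_left)
qed

lemma finite_bounded_separated:
  fixes X :: "'a::euclidean_space set"
  assumes "0 < e" "pairwise (\<lambda>x y. e \<le> dist x y) X" "bounded X"
  shows "finite X"
proof (rule ccontr)
  assume "infinite X"
  have "closed X"
  proof (rule discrete_imp_closed[OF assms(1)])
    show "\<forall>x\<in>X. \<forall>y\<in>X. dist y x < e \<longrightarrow> y = x"
      using assms(2) unfolding pairwise_def by (metis leD)
  qed
  then have "compact X" using assms(3) compact_eq_bounded_closed by blast
  then obtain a where "a \<in> X" "a islimpt X"
    using \<open>infinite X\<close> unfolding compact_eq_Bolzano_Weierstrass by blast
  then obtain y where "y \<in> X" "y \<noteq> a" "dist y a < e"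
    using assms(1) unfolding islimpt_approachable by blast
  with \<open>a \<in> X\<close> assms(2) show False unfolding pairwise_def by (metis leD)
qed

lemma bounded_half_open_cube: "bounded (half_open_cube z r)"
proof (cases "half_open_cube z r = {}")
  case False
  then obtain x where "x \<in> half_open_cube z r" by blast
  then show ?thesis unfolding bounded_def using dist_half_open_cube by blast
qed simp

lemma finite_cubic_lattice: "0 < l \<Longrightarrow> bounded A \<Longrightarrow> finite (cubic_lattice l \<inter> (A::'a::euclidean_space set))"
  by (rule finite_bounded_separated[of l]) (simp_all add: pairwise_def cubic_lattice_dist bounded_Int)

lemma omega_eq: "omega TYPE('a::euclidean_space) = unit_ball_vol DIM('a)"
  unfolding omega_def by (subst content_ball) simp_all

lemma omega_pos: "0 < omega TYPE('a::euclidean_space)"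
  unfolding omega_eq by (rule unit_ball_vol_pos) simp

lemma emeasure_ball_omega:
  "0 \<le> r \<Longrightarrow> emeasure lborel (ball (c::'a::euclidean_space) r) = ennreal (omega TYPE('a) * r ^ DIM('a))"
  unfolding omega_eq by (rule emeasure_ball)

text \<open>
  The packing bound and the interaction bound both rest on this fact: the balls of radius \<open>\<epsilon>\<close> around
  \<open>2\<epsilon>\<close>-separated points are disjoint. It is used with Lebesgue measure, to count points, and with
  density \<open>|y|\<^bsup>-s\<^esup>\<close>, to bound interactions.
\<close>

lemma sum_emeasure_balls_le:
  fixes x :: "'i \<Rightarrow> 'a::euclidean_space"
  assumes "finite I" "sets M = sets borel" "A \<in> sets M"
    and "\<And>i j. i \<in> I \<Longrightarrow> j \<in> I \<Longrightarrow> i \<noteq> j \<Longrightarrow> 2 * \<epsilon> \<le> dist (x i) (x j)"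
    and "\<And>i. i \<in> I \<Longrightarrow> ball (x i) \<epsilon> \<subseteq> A"
  shows "(\<Sum>i\<in>I. emeasure M (ball (x i) \<epsilon>)) \<le> emeasure M A"
proof -
  have disj: "disjoint_family_on (\<lambda>i. ball (x i) \<epsilon>) I"
    unfolding disjoint_family_on_def
  proof (intro ballI impI)
    fix i j assume "i \<in> I" "j \<in> I" "i \<noteq> j"
    then have "2 * \<epsilon> \<le> dist (x i) (x j)" by (rule assms(4))
    then show "ball (x i) \<epsilon> \<inter> ball (x j) \<epsilon> = {}" by (intro disjoint_ballI) linarith
  qed
  have "ball (x i) \<epsilon> \<in> sets M" for i unfolding assms(2) by simp
  then have "(\<Sum>i\<in>I. emeasure M (ball (x i) \<epsilon>)) = emeasure M (\<Union>i\<in>I. ball (x i) \<epsilon>)"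
    by (intro sum_emeasure disj assms(1)) blast
  also have "\<dots> \<le> emeasure M A" by (rule emeasure_mono[OF UN_least[OF assms(5)] assms(3)])
  finally show ?thesis .
qed

text \<open>
  The unit balls around the points are disjoint and stay in a cube of side \<open>r + 2\<close>.
\<close>

lemma card_packing_le:
  fixes X :: "'a::euclidean_space set"
  assumes "X \<in> Ad" "0 < r"
  shows "real (card (X \<inter> half_open_cube 0 r)) * omega TYPE('a) \<le> (r + 2) ^ DIM('a)"
proof -
  let ?Y = "X \<inter> half_open_cube 0 r"
  have sep: "pairwise (\<lambda>x y. 2 \<le> dist x y) ?Y"
    using assms(1) by (auto simp: Ad_def pairwise_def)
  have fin: "finite ?Y"
    by (rule finite_bounded_separated[OF _ sep]) (auto intro: bounded_subset[OF bounded_half_open_cube])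
  have "(\<Sum>y\<in>?Y. emeasure lborel (ball y 1)) \<le> emeasure lborel (half_open_cube (- (\<Sum>b\<in>Basis. b)) (r + 2) :: 'a set)"
  proof (intro sum_emeasure_balls_le fin)
    fix y assume y: "y \<in> ?Y"
    show "ball y 1 \<subseteq> half_open_cube (- (\<Sum>b\<in>Basis. b)) (r + 2)"
    proof
      fix u assume "u \<in> ball y 1"
      show "u \<in> half_open_cube (- (\<Sum>b\<in>Basis. b)) (r + 2)"
        unfolding half_open_cube_def mem_Collect_eq
      proof
        fix b :: 'a assume b: "b \<in> Basis"
        have "\<bar>(y - u) \<bullet> b\<bar> < 1"
          using Basis_le_norm[OF b, of "y - u"] \<open>u \<in> ball y 1\<close> by (simp add: dist_norm)
        moreover have "0 \<le> y \<bullet> b" "y \<bullet> b < r" using y b by (auto simp: half_open_cube_def)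
        moreover have "(- (\<Sum>b\<in>Basis. b)) \<bullet> b = -1" using b by (simp add: inner_sum_left inner_Basis)
        ultimately show "(- (\<Sum>b\<in>Basis. b)) \<bullet> b \<le> u \<bullet> b \<and> u \<bullet> b < (- (\<Sum>b\<in>Basis. b)) \<bullet> b + (r + 2)"
          by (simp add: inner_diff_left abs_less_iff)
      qed
    qed
  qed (use sep in \<open>auto simp: pairwise_def\<close>)
  then have "ennreal (real (card ?Y) * omega TYPE('a)) \<le> ennreal ((r + 2) ^ DIM('a))"
    using assms(2) by (simp add: emeasure_ball_omega emeasure_half_open_cube ennreal_mult' ennreal_of_nat_eq_real_of_nat)
  then show ?thesis using assms(2) by (subst (asm) ennreal_le_iff) auto
qed

lemma packing_ratio_le:
  fixes X :: "'a::euclidean_space set"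
  assumes "X \<in> Ad" "1 \<le> r"
  shows "real (card (X \<inter> half_open_cube 0 r)) * omega TYPE('a) / r ^ DIM('a) \<le> 3 ^ DIM('a)"
proof -
  have "real (card (X \<inter> half_open_cube 0 r)) * omega TYPE('a) \<le> (r + 2) ^ DIM('a)"
    using card_packing_le assms by force
  also have "\<dots> \<le> (3 * r) ^ DIM('a)" using assms(2) by (intro power_mono) auto
  finally show ?thesis using assms(2) by (simp add: power_mult_distrib divide_le_eq)
qed

lemma cubic_lattice_Ad: "cubic_lattice 2 \<in> Ad"
  by (simp add: Ad_def pairwise_def cubic_lattice_dist)

text \<open>
  The cubes of side 2 at the lattice points in \<open>[0, r)\<^sup>d\<close> cover that cube, so there are at least
  \<open>(r/2)\<^sup>d\<close> of them.
\<close>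

lemma cubic_lattice_ratio:
  assumes "0 < r"
  shows "omega TYPE('a) / 2 ^ DIM('a) \<le>
    real (card (cubic_lattice 2 \<inter> half_open_cube (0::'a::euclidean_space) r)) * omega TYPE('a) / r ^ DIM('a)"
proof -
  let ?Y = "cubic_lattice 2 \<inter> half_open_cube (0::'a) r"
  have fin: "finite ?Y" by (intro finite_cubic_lattice bounded_half_open_cube) simp
  have "half_open_cube 0 r \<subseteq> (\<Union>z\<in>?Y. half_open_cube z 2)"
  proof
    fix x :: 'a assume x: "x \<in> half_open_cube 0 r"
    obtain z where z: "z \<in> cubic_lattice 2" "x \<in> half_open_cube z 2" "\<And>b. b \<in> Basis \<Longrightarrow> 0 \<le> x \<bullet> b \<Longrightarrow> 0 \<le> z \<bullet> b"
      by (rule cubic_lattice_cover[of 2 x]) auto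
    have "z \<in> half_open_cube 0 r"
      using x z(2,3) by (fastforce simp: half_open_cube_def)
    with z show "x \<in> (\<Union>z\<in>?Y. half_open_cube z 2)" by blast
  qed
  then have "emeasure lborel (half_open_cube (0::'a) r) \<le> emeasure lborel (\<Union>z\<in>?Y. half_open_cube z 2)"
    by (intro emeasure_mono sets.finite_UN[OF fin]) (auto simp: fin)
  also have "\<dots> \<le> (\<Sum>z\<in>?Y. emeasure lborel (half_open_cube z 2))"
    by (intro emeasure_subadditive_finite fin) auto
  also have "\<dots> = ennreal (real (card ?Y) * 2 ^ DIM('a))"
    by (simp add: emeasure_half_open_cube ennreal_mult' ennreal_of_nat_eq_real_of_nat)
  finally have "r ^ DIM('a) \<le> real (card ?Y) * 2 ^ DIM('a)"
    using assms by (simp add: emeasure_half_open_cube)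
  then have "r ^ DIM('a) * omega TYPE('a) \<le> real (card ?Y) * 2 ^ DIM('a) * omega TYPE('a)"
    by (rule mult_right_mono) (use omega_pos[where 'a='a] in simp)
  then show ?thesis using assms by (simp add: field_simps)
qed

text \<open>
  The supremum is at most \<open>3\<^sup>d\<close> by volume comparison and at least \<open>\<omega>\<^sub>d / 2\<^sup>d\<close> because of the lattice
  \<open>2\<int>\<^sup>d\<close>; hence passing to real numbers in the definition is harmless, and one may divide by
  the density.
\<close>

lemma packing_density_SUP:
  "ereal (packing_density TYPE('a::euclidean_space)) = (SUP X\<in>(Ad :: 'a set set).
     Limsup at_top (\<lambda>r. ereal (real (card (X \<inter> half_open_cube 0 r)) * omega TYPE('a) / r ^ DIM('a))))"
  (is "_ = ?S")
  and packing_density_pos: "0 < packing_density TYPE('a::euclidean_space)"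
proof -
  have ratio: "Limsup at_top (\<lambda>r::real. ereal (real (card (X \<inter> (*\<^sub>R) r ` unit_cube)) * omega TYPE('a)
                 / measure lborel ((*\<^sub>R) r ` (unit_cube :: 'a set)))) =
      Limsup at_top (\<lambda>r. ereal (real (card (X \<inter> half_open_cube 0 r)) * omega TYPE('a) / r ^ DIM('a)))"
    for X :: "'a set"
    by (intro Limsup_eq eventually_mono[OF eventually_gt_at_top[of 0]])
      (simp add: scaleR_unit_cube measure_half_open_cube)
  have C: "packing_density TYPE('a) = real_of_ereal ?S"
    unfolding packing_density_def ratio ..
  have up: "?S \<le> ereal (3 ^ DIM('a))"
  proof (intro SUP_least Limsup_bounded)
    fix X :: "'a set" assume "X \<in> Ad"
    then show "\<forall>\<^sub>F r in at_top. ereal (real (card (X \<inter> half_open_cube 0 r)) * omega TYPE('a) / r ^ DIM('a)) \<le> ereal (3 ^ DIM('a))"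
      by (intro eventually_mono[OF eventually_ge_at_top[of 1]]) (use packing_ratio_le in auto)
  qed
  have "ereal (omega TYPE('a) / 2 ^ DIM('a)) \<le>
    Limsup at_top (\<lambda>r. ereal (real (card (cubic_lattice 2 \<inter> half_open_cube (0::'a) r)) * omega TYPE('a) / r ^ DIM('a)))"
  proof (rule order_trans[OF Liminf_bounded Liminf_le_Limsup])
    show "\<forall>\<^sub>F r in at_top. ereal (omega TYPE('a) / 2 ^ DIM('a)) \<le>
       ereal (real (card (cubic_lattice 2 \<inter> half_open_cube (0::'a) r)) * omega TYPE('a) / r ^ DIM('a))"
      by (intro eventually_mono[OF eventually_gt_at_top[of 0]]) (use cubic_lattice_ratio in auto)
  qed simp
  also have "\<dots> \<le> ?S" by (intro SUP_upper cubic_lattice_Ad)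
  finally have low: "ereal (omega TYPE('a) / 2 ^ DIM('a)) \<le> ?S" .
  have "\<bar>?S\<bar> \<noteq> \<infinity>" using up low by auto
  then show eq: "ereal (packing_density TYPE('a)) = ?S" by (simp add: C ereal_real)
  have "omega TYPE('a) / 2 ^ DIM('a) \<le> packing_density TYPE('a)"
    using low unfolding eq[symmetric] by simp
  then show "0 < packing_density TYPE('a)"
    using omega_pos[where 'a='a] by (smt (verit) divide_pos_pos zero_less_power)
qed

text \<open>
  The limes superior in the definition yields arbitrarily large cubes, not all large cubes, in
  which a packing beats \<open>c\<close>; this suffices because one good cube can be repeated periodically.
\<close>

lemma near_optimal_packing:
  fixes c R :: real
  assumes "c < packing_density TYPE('a::euclidean_space)"
  obtains r and P :: "'a::euclidean_space set" where "R \<le> r" "0 < r" "P \<subseteq> half_open_cube 0 r" "finite P"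
    "pairwise (\<lambda>x y. 2 \<le> dist x y) P" "c < real (card P) * omega TYPE('a) / r ^ DIM('a)"
proof -
  let ?q = "\<lambda>(X::'a set) r. real (card (X \<inter> half_open_cube 0 r)) * omega TYPE('a) / r ^ DIM('a)"
  have "ereal c < (SUP X\<in>(Ad :: 'a set set). Limsup at_top (\<lambda>r. ereal (?q X r)))"
    unfolding packing_density_SUP[symmetric] using assms by simp
  then obtain X :: "'a set" where X: "X \<in> Ad" "ereal c < Limsup at_top (\<lambda>r. ereal (?q X r))"
    unfolding less_SUP_iff by blast
  have "\<not> (\<forall>\<^sub>F r in at_top. ereal (?q X r) \<le> ereal c)"
    using Limsup_bounded[of "\<lambda>r. ereal (?q X r)" "ereal c" at_top] X(2) by (metis leD)
  then obtain r where r: "max R 1 \<le> r" "c < ?q X r"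
    unfolding eventually_at_top_linorder by (metis ereal_less_eq(3) not_le)
  have sep: "pairwise (\<lambda>x y. 2 \<le> dist x y) (X \<inter> half_open_cube 0 r)"
    using X(1) by (auto simp: Ad_def pairwise_def)
  moreover have "finite (X \<inter> half_open_cube 0 r)"
    by (rule finite_bounded_separated[OF _ sep]) (auto intro: bounded_subset[OF bounded_half_open_cube])
  ultimately show ?thesis using that[of r "X \<inter> half_open_cube 0 r"] r by auto
qed

section \<open>Riesz kernels and their truncations\<close>

text \<open>
  At 0 the value is \<open>1 / 0 = 0\<close>, as on the diagonal in the limit energy.
\<close>

definition riesz_kernel :: "real \<Rightarrow> 'a::euclidean_space \<Rightarrow> real" where
  "riesz_kernel s z = 1 / norm z powr s"

definition truncated_kernel :: "real \<Rightarrow> real \<Rightarrow> 'a::euclidean_space \<Rightarrow> real" where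
  "truncated_kernel s r z = 1 / max (norm z) r powr s"

lemma riesz_kernel_borel [measurable]: "riesz_kernel s \<in> borel_measurable borel"
  unfolding riesz_kernel_def by measurable

lemma riesz_kernel_nonneg: "0 \<le> riesz_kernel s z"
  by (simp add: riesz_kernel_def)

lemma truncated_kernel_nonneg: "0 \<le> truncated_kernel s r z"
  by (simp add: truncated_kernel_def)

lemma truncated_kernel_le:
  assumes "0 < r" "0 \<le> s"
  shows "truncated_kernel s r z \<le> 1 / r powr s"
  unfolding truncated_kernel_def using assms by (intro divide_left_mono powr_mono2) auto

lemma truncated_kernel_le_riesz:
  assumes "0 < r" "0 \<le> s" "z \<noteq> 0"
  shows "truncated_kernel s r z \<le> riesz_kernel s z"
  unfolding truncated_kernel_def riesz_kernel_def using assms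
  by (intro divide_left_mono powr_mono2) auto

lemma truncated_kernel_eq: "r \<le> norm z \<Longrightarrow> truncated_kernel s r z = riesz_kernel s z"
  by (simp add: truncated_kernel_def riesz_kernel_def max_def)

lemma continuous_truncated_kernel:
  assumes "0 < r"
  shows "continuous_on UNIV (truncated_kernel s r)"
  unfolding truncated_kernel_def using assms by (intro continuous_intros) auto

text \<open>
  On \<open>[r, \<infinity>)\<close> the function \<open>t \<mapsto> t\<^bsup>-s\<^esup>\<close> has derivative bounded by \<open>s r\<^bsup>-(s+1)\<^esup>\<close>, and
  \<open>z \<mapsto> max |z| r\<close> is 1-Lipschitz.
\<close>

lemma uniformly_continuous_truncated_kernel:
  assumes "0 < r" "0 < s"
  shows "uniformly_continuous_on UNIV (truncated_kernel s r :: 'a::euclidean_space \<Rightarrow> real)"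
proof -
  have uc: "uniformly_continuous_on {r..} (\<lambda>t::real. 1 / t powr s)"
  proof (rule lipschitz_on_uniformly_continuous[where L="s / r powr (s + 1)"], rule bounded_derivative_imp_lipschitz)
    fix t assume t: "t \<in> {r..}"
    show "((\<lambda>t. 1 / t powr s) has_derivative (\<lambda>h. (- s * t powr (- s - 1)) * h)) (at t within {r..})"
      using t assms by (auto intro!: derivative_eq_intros simp: powr_minus_divide powr_diff powr_add field_simps power2_eq_square)
    have "\<bar>- s * t powr (- s - 1)\<bar> \<le> s / r powr (s + 1)"
    proof -
      have "t powr (- s - 1) \<le> r powr (- s - 1)" using t assms by (intro powr_mono2') auto
      also have "\<dots> = 1 / r powr (s + 1)"
        using powr_minus_divide[of r "s + 1"] by simp
      finally show ?thesis using assms by (simp add: abs_mult divide_simps mult_left_mono)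
    qed
    from mult_right_mono[OF this abs_ge_zero]
    have "norm (- s * t powr (- s - 1) * h) \<le> s / r powr (s + 1) * norm h" for h
      by (simp only: real_norm_def abs_mult)
    then show "onorm ((*) (- s * t powr (- s - 1))) \<le> s / r powr (s + 1)"
      by (rule onorm_le)
  qed (use assms in auto)
  show ?thesis
    unfolding uniformly_continuous_on_def
  proof (intro allI impI)
    fix e :: real assume "0 < e"
    then obtain d where d: "0 < d"
      "\<forall>t\<in>{r..}. \<forall>t'\<in>{r..}. dist t' t < d \<longrightarrow> dist (1 / t' powr s) (1 / t powr s) < e"
      using uc unfolding uniformly_continuous_on_def by blast
    have "dist (truncated_kernel s r z') (truncated_kernel s r z) < e" if "dist z' z < d" for z z' :: 'a
    proof -
      have "dist (max (norm z') r) (max (norm z) r) \<le> \<bar>norm z' - norm z\<bar>"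
        unfolding dist_real_def by linarith
      also have "\<dots> < d"
        using norm_triangle_ineq3[of z' z] that unfolding dist_norm by linarith
      finally show ?thesis unfolding truncated_kernel_def
        by (intro d(2)[rule_format]) auto
    qed
    then show "\<exists>d>0. \<forall>x\<in>UNIV. \<forall>x'\<in>UNIV. dist x' x < d \<longrightarrow>
        dist (truncated_kernel s r (x' :: 'a)) (truncated_kernel s r x) < e"
      using d(1) by blast
  qed
qed

text \<open>
  On the dyadic shell \<open>2\<^bsup>-(k+1)\<^esup> \<le> |y| < 2\<^bsup>-k\<^esup>\<close> the kernel is at most \<open>2\<^bsup>s(k+1)\<^esup>\<close>. Using whole balls
  instead of shells costs nothing in the application and spares a disjointness argument.
\<close>

lemma riesz_kernel_le_shells:
  fixes y :: "'a::euclidean_space"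
  assumes "0 < s"
  shows "ennreal (riesz_kernel s y) * indicator (ball 0 1) y
    \<le> (\<Sum>k. ennreal (2 powr (s * (real k + 1))) * indicator (ball 0 ((1 / 2) ^ k)) y)"
proof (cases "y = 0 \<or> y \<notin> ball 0 1")
  case True
  then show ?thesis by (auto simp: riesz_kernel_def)
next
  case False
  then have y: "0 < norm y" "norm y < 1" by auto
  obtain n where n: "(1 / 2) ^ n < norm y"
    using real_arch_pow_inv[OF y(1), of "1 / 2"] by auto
  \<comment> \<open>the index of the shell containing \<open>y\<close>, plus one\<close>
  define m where "m = (LEAST n. (1 / 2) ^ n \<le> norm y)"
  have m: "(1 / 2) ^ m \<le> norm y"
    unfolding m_def by (rule LeastI[of _ n]) (use n in simp)
  have "m \<noteq> 0" using m y(2) by (intro notI) simp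
  then obtain k where k: "m = Suc k" using not0_implies_Suc by blast
  have up: "norm y < (1 / 2) ^ k"
    using not_less_Least[of k "\<lambda>n. (1 / 2) ^ n \<le> norm y"] k m_def by simp
  have "1 / norm y powr s \<le> 1 / ((1 / 2) ^ Suc k) powr s"
    using m k y assms by (intro divide_left_mono powr_mono2 mult_pos_pos) auto
  also have "(1 / 2 :: real) ^ Suc k = 2 powr (- (real k + 1))"
    unfolding powr_minus by (simp add: powr_add powr_realpow power_one_over inverse_eq_divide)
  also have "1 / (2 powr (- (real k + 1))) powr s = 2 powr (s * (real k + 1))"
    unfolding powr_powr mult_minus_left by (subst powr_minus_divide) (simp add: mult.commute)
  finally have "ennreal (riesz_kernel s y) * indicator (ball 0 1) y
      \<le> ennreal (2 powr (s * (real k + 1))) * indicator (ball 0 ((1 / 2) ^ k)) y"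
    using up y by (auto simp: riesz_kernel_def intro!: ennreal_leI)
  also have "\<dots> \<le> (\<Sum>k. ennreal (2 powr (s * (real k + 1))) * indicator (ball 0 ((1 / 2) ^ k)) y)"
  proof -
    have "f k \<le> suminf f" for f :: "nat \<Rightarrow> ennreal"
      using sum_le_suminf[OF summableI, of "{k}" f] by simp
    then show ?thesis .
  qed
  finally show ?thesis .
qed

text \<open>
  The \<open>k\<close>-th term of the shell bound integrates to a multiple of \<open>2\<^bsup>k(s-d)\<^esup>\<close>, a convergent
  geometric series since \<open>s < d\<close>.
\<close>

lemma riesz_kernel_locally_integrable:
  assumes "0 < s" "s < real DIM('a::euclidean_space)"
  shows "(\<integral>\<^sup>+y\<in>ball (0::'a) 1. riesz_kernel s y \<partial>lborel) < \<infinity>"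
proof -
  define q where "q = 2 powr (s - DIM('a))"
  have q: "0 < q" "q < 1"
  proof -
    show "0 < q" by (simp add: q_def)
    have "2 powr (s - DIM('a)) < 2 powr (0 :: real)"
      using assms(2) by (intro powr_less_mono) auto
    then show "q < 1" by (simp add: q_def)
  qed
  have "(\<integral>\<^sup>+y\<in>ball (0::'a) 1. riesz_kernel s y \<partial>lborel)
      \<le> (\<integral>\<^sup>+y. (\<Sum>k. ennreal (2 powr (s * (real k + 1))) * indicator (ball 0 ((1 / 2) ^ k)) (y::'a)) \<partial>lborel)"
    by (intro nn_integral_mono riesz_kernel_le_shells assms)
  also have "\<dots> = (\<Sum>k. \<integral>\<^sup>+y. ennreal (2 powr (s * (real k + 1))) * indicator (ball 0 ((1 / 2) ^ k)) (y::'a) \<partial>lborel)"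
  proof (rule nn_integral_suminf)
    fix k :: nat
    have "ball (0::'a) ((1 / 2) ^ k) \<in> sets lborel"
      unfolding sets_lborel by (rule borel_open[OF open_ball])
    then show "(\<lambda>y. ennreal (2 powr (s * (real k + 1))) * indicator (ball 0 ((1 / 2) ^ k)) (y::'a)) \<in> borel_measurable lborel"
      by (intro borel_measurable_times_ennreal borel_measurable_const borel_measurable_indicator)
  qed
  also have "\<dots> = (\<Sum>k. ennreal (2 powr s * omega TYPE('a) * q ^ k))"
  proof (intro arg_cong[where f=suminf] ext)
    fix k
    have "(\<integral>\<^sup>+y. ennreal (2 powr (s * (real k + 1))) * indicator (ball 0 ((1 / 2) ^ k)) (y::'a) \<partial>lborel)
        = ennreal (2 powr (s * (real k + 1))) * ennreal (omega TYPE('a) * ((1 / 2) ^ k) ^ DIM('a))"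
      by (simp add: nn_integral_cmult_indicator emeasure_ball_omega)
    also have "\<dots> = ennreal (2 powr (s * (real k + 1)) * (omega TYPE('a) * ((1 / 2) ^ k) ^ DIM('a)))"
      by (rule ennreal_mult'[symmetric]) simp
    also have "((1 / 2 :: real) ^ k) ^ DIM('a) = 2 powr (- real DIM('a) * k)"
      by (simp add: powr_minus power_one_over powr_realpow field_simps flip: power_mult of_nat_mult)
    also have "2 powr (s * (real k + 1)) * (omega TYPE('a) * 2 powr (- real DIM('a) * k)) = 2 powr s * omega TYPE('a) * q ^ k"
    proof -
      have "q ^ k = 2 powr ((s - DIM('a)) * k)" by (simp add: q_def powr_power mult.commute)
      moreover have "s * (real k + 1) + - real DIM('a) * k = s + (s - DIM('a)) * k"
        by (simp add: algebra_simps)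
      then have "2 powr (s * (real k + 1)) * 2 powr (- real DIM('a) * k) = 2 powr s * 2 powr ((s - DIM('a)) * k)"
        unfolding powr_add[symmetric] by simp
      ultimately have "2 powr (s * (real k + 1)) * 2 powr (- real DIM('a) * k) = 2 powr s * q ^ k"
        by (simp only:)
      then have "omega TYPE('a) * (2 powr (s * (real k + 1)) * 2 powr (- real DIM('a) * k))
          = omega TYPE('a) * (2 powr s * q ^ k)" by (rule arg_cong)
      then show ?thesis by (simp only: ac_simps)
    qed
    finally show "(\<integral>\<^sup>+y. ennreal (2 powr (s * (real k + 1))) * indicator (ball 0 ((1 / 2) ^ k)) (y::'a) \<partial>lborel)
        = ennreal (2 powr s * omega TYPE('a) * q ^ k)" .
  qed
  also have "\<dots> < \<infinity>"
  proof -
    have "summable (\<lambda>k. 2 powr s * omega TYPE('a) * q ^ k)"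
      using q by (intro summable_mult summable_geometric) simp
    then have "(\<Sum>k. ennreal (2 powr s * omega TYPE('a) * q ^ k)) = ennreal (\<Sum>k. 2 powr s * omega TYPE('a) * q ^ k)"
      using q omega_pos[where 'a='a] by (intro suminf_ennreal2) (auto intro: mult_nonneg_nonneg less_imp_le)
    then show ?thesis by simp
  qed
  finally show ?thesis .
qed

lemma emeasure_riesz_ball:
  "emeasure (density lborel (\<lambda>y. ennreal (riesz_kernel s y))) (ball c r) =
    (\<integral>\<^sup>+y\<in>ball c r. riesz_kernel s y \<partial>lborel)"
  by (subst emeasure_density) simp_all

text \<open>
  Continuity from above of the measure with density \<open>|y|\<^bsup>-s\<^esup>\<close>, which is finite on the unit
  ball and has no atom at 0.
\<close>

lemma riesz_kernel_small_ball:
  fixes \<delta> :: ennreal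
  assumes "0 < s" "s < real DIM('a::euclidean_space)" "0 < \<delta>"
  obtains r where "0 < r" "(\<integral>\<^sup>+y\<in>ball (0::'a) r. riesz_kernel s y \<partial>lborel) < \<delta>"
proof -
  let ?D = "density lborel (\<lambda>y::'a. ennreal (riesz_kernel s y))"
  let ?B = "\<lambda>n. ball (0::'a) (1 / Suc n)"
  have Int: "(\<Inter>n. ?B n) = {0}"
  proof (intro equalityI subsetI)
    fix x assume x: "x \<in> (\<Inter>n. ?B n)"
    show "x \<in> {0}"
    proof (rule ccontr)
      assume "x \<notin> {0}"
      then obtain n where "1 / Suc n < norm x"
        using nat_approx_posE[of "norm x"] by auto
      moreover have "norm x < 1 / Suc n" using x by auto
      ultimately show False by simp
    qed
  qed auto
  have "(\<lambda>n. emeasure ?D (?B n)) \<longlonglongrightarrow> emeasure ?D (\<Inter>n. ?B n)"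
  proof (rule Lim_emeasure_decseq)
    show "decseq ?B"
      by (auto simp: decseq_def field_simps intro!: subset_ball)
    fix n
    have "emeasure ?D (?B n) \<le> emeasure ?D (ball 0 1)"
      by (intro emeasure_mono) (auto simp: field_simps intro!: subset_ball)
    also have "\<dots> < \<infinity>" unfolding emeasure_riesz_ball using riesz_kernel_locally_integrable assms(1,2) by blast
    finally show "emeasure ?D (?B n) \<noteq> \<infinity>" by simp
  qed auto
  also have "emeasure ?D (\<Inter>n. ?B n) = 0"
    unfolding Int by (simp add: emeasure_density nn_integral_indicator_singleton)
  finally have "\<forall>\<^sub>F n in sequentially. emeasure ?D (?B n) < \<delta>"
    by (rule order_tendstoD(2)) (use assms(3) in simp)
  then obtain n where "emeasure ?D (?B n) < \<delta>" using eventually_happens' by force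
  then show ?thesis using that[of "1 / Suc n"] unfolding emeasure_riesz_ball by simp
qed

text \<open>
  For \<open>y\<close> in the ball of radius \<open>\<epsilon>\<close> around \<open>x\<^sub>j - x\<^sub>i\<close>, separation gives
  \<open>|y| \<le> |x\<^sub>j - x\<^sub>i| + \<epsilon> \<le> 3/2 |x\<^sub>j - x\<^sub>i|\<close>. So the kernel at \<open>x\<^sub>j - x\<^sub>i\<close> is at most \<open>(3/2)\<^sup>s\<close> times
  its values on that ball, and the sum is bounded by an integral over disjoint balls. The bound is
  independent of \<open>\<epsilon>\<close> and of the number of points.
\<close>

lemma sum_riesz_kernel_near:
  fixes x :: "nat \<Rightarrow> 'a::euclidean_space"
  assumes "0 < \<epsilon>" "separated \<epsilon> N x" "i < N" "0 < s"
  shows "(\<Sum>j\<in>{j. j < N \<and> j \<noteq> i \<and> dist (x i) (x j) < r}.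
      ennreal (omega TYPE('a) * \<epsilon> ^ DIM('a) * riesz_kernel s (x i - x j)))
    \<le> ennreal ((3 / 2) powr s) * (\<integral>\<^sup>+y\<in>ball (0::'a) (3 / 2 * r). riesz_kernel s y \<partial>lborel)"
proof -
  let ?J = "{j. j < N \<and> j \<noteq> i \<and> dist (x i) (x j) < r}"
  let ?D = "density lborel (\<lambda>y::'a. ennreal (riesz_kernel s y))"
  let ?p = "\<lambda>j. x j - x i"
  have far: "2 * \<epsilon> \<le> dist (x i) (x j)" if "j \<in> ?J" for j
    using assms(2,3) that unfolding separated_def by auto
  have "ennreal (omega TYPE('a) * \<epsilon> ^ DIM('a) * riesz_kernel s (x i - x j))
      \<le> ennreal ((3 / 2) powr s) * emeasure ?D (ball (?p j) \<epsilon>)" if j: "j \<in> ?J" for j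
  proof -
    define t where "t = dist (x i) (x j)"
    have t: "2 * \<epsilon> \<le> t" "norm (x i - x j) = t" "0 < t"
      using far[OF j] assms(1) by (auto simp: t_def dist_norm)
    have "ennreal (omega TYPE('a) * \<epsilon> ^ DIM('a) * riesz_kernel s (x i - x j)) =
        ennreal (omega TYPE('a) * \<epsilon> ^ DIM('a)) * ennreal (riesz_kernel s (x i - x j))"
      by (rule ennreal_mult'') (rule riesz_kernel_nonneg)
    also have "\<dots> = ennreal (riesz_kernel s (x i - x j)) * emeasure lborel (ball (?p j) \<epsilon>)"
      using assms(1) by (subst emeasure_ball_omega) (simp_all add: mult.commute)
    also have "\<dots> = (\<integral>\<^sup>+y. ennreal (riesz_kernel s (x i - x j)) * indicator (ball (?p j) \<epsilon>) y \<partial>lborel)"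
      by (rule nn_integral_cmult_indicator[symmetric]) simp
    also have "\<dots> \<le> (\<integral>\<^sup>+y. ennreal ((3 / 2) powr s) * (ennreal (riesz_kernel s y) * indicator (ball (?p j) \<epsilon>) y) \<partial>lborel)"
    proof (intro nn_integral_mono)
      fix y
      have "riesz_kernel s (x i - x j) \<le> (3 / 2) powr s * riesz_kernel s y" if "y \<in> ball (?p j) \<epsilon>"
      proof -
        have y: "norm (x j - x i - y) < \<epsilon>" using that by (simp add: dist_norm)
        have n: "norm (x j - x i) = t" using t(2) by (simp add: norm_minus_commute)
        have "\<bar>t - norm y\<bar> < \<epsilon>"
          using order_le_less_trans[OF norm_triangle_ineq3 y] unfolding n .
        then have "norm y \<le> 3 / 2 * t" "0 < norm y"
          using t(1,3) assms(1) by linarith+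
        have "norm y powr s \<le> (3 / 2 * t) powr s"
          using \<open>norm y \<le> 3 / 2 * t\<close> assms(4) by (intro powr_mono2) auto
        also have "\<dots> = (3 / 2) powr s * t powr s" by (rule powr_mult)
        finally show ?thesis
          unfolding riesz_kernel_def t(2) using \<open>0 < norm y\<close> t(3) by (simp add: field_simps)
      qed
      then show "ennreal (riesz_kernel s (x i - x j)) * indicator (ball (?p j) \<epsilon>) y
          \<le> ennreal ((3 / 2) powr s) * (ennreal (riesz_kernel s y) * indicator (ball (?p j) \<epsilon>) y)"
        by (cases "y \<in> ball (?p j) \<epsilon>") (simp_all add: ennreal_mult'[symmetric] ennreal_leI)
    qed
    also have "\<dots> = ennreal ((3 / 2) powr s) * emeasure ?D (ball (?p j) \<epsilon>)"
      unfolding emeasure_riesz_ball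
      by (intro nn_integral_cmult borel_measurable_times_ennreal borel_measurable_indicator) simp_all
    finally show ?thesis .
  qed
  then have "(\<Sum>j\<in>?J. ennreal (omega TYPE('a) * \<epsilon> ^ DIM('a) * riesz_kernel s (x i - x j)))
      \<le> ennreal ((3 / 2) powr s) * (\<Sum>j\<in>?J. emeasure ?D (ball (?p j) \<epsilon>))"
    unfolding sum_distrib_left by (rule sum_mono)
  also have "(\<Sum>j\<in>?J. emeasure ?D (ball (?p j) \<epsilon>)) \<le> emeasure ?D (ball 0 (3 / 2 * r))"
  proof (rule sum_emeasure_balls_le)
    fix j k assume "j \<in> ?J" "k \<in> ?J" "j \<noteq> k"
    then show "2 * \<epsilon> \<le> dist (?p j) (?p k)"
      using assms(2) by (auto simp: separated_def dist_norm)
  next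
    fix j assume j: "j \<in> ?J"
    then have "dist (x i) (x j) < r" by simp
    with far[OF j] show "ball (?p j) \<epsilon> \<subseteq> ball 0 (3 / 2 * r)"
      by (subst ball_subset_ball_iff) (auto simp: dist_norm norm_minus_commute)
  qed auto
  finally show ?thesis unfolding emeasure_riesz_ball by (simp add: mult_left_mono)
qed

section \<open>Double integrals under tight convergence\<close>

lemma MbD:
  assumes "M \<in> Mb"
  shows "finite_measure M" "sets M = sets borel" "space M = UNIV"
  using assms sets_eq_imp_space_eq[of M borel] by (auto simp: Mb_def)

lemma Mb_integrable:
  fixes f :: "'a::euclidean_space \<Rightarrow> real"
  assumes "M \<in> Mb" "f \<in> borel_measurable borel" "\<And>x. \<bar>f x\<bar> \<le> B"
  shows "integrable M f"
proof -
  interpret finite_measure M using MbD(1)[OF assms(1)] .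
  have "f \<in> borel_measurable M" using assms(2) MbD(2)[OF assms(1)] by (simp cong: measurable_cong_sets)
  then show ?thesis by (intro integrable_const_bound[of _ B]) (use assms(3) in auto)
qed

lemma Mb_integral_const: "M \<in> Mb \<Longrightarrow> (\<integral>x. c \<partial>M) = c * measure M UNIV"
  by (simp add: MbD(3))

lemma Mb_integral_bound:
  fixes f :: "'a::euclidean_space \<Rightarrow> real"
  assumes "M \<in> Mb" "f \<in> borel_measurable borel" "\<And>x. \<bar>f x\<bar> \<le> B"
  shows "\<bar>\<integral>x. f x \<partial>M\<bar> \<le> B * measure M UNIV"
proof -
  have "\<bar>\<integral>x. f x \<partial>M\<bar> \<le> (\<integral>x. \<bar>f x\<bar> \<partial>M)" by (rule integral_abs_bound)
  also have "\<dots> \<le> (\<integral>x. B \<partial>M)"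
    using assms by (intro integral_mono Mb_integrable[where B=B] Mb_integrable[where B="\<bar>B\<bar>"]) auto
  also have "\<dots> = B * measure M UNIV" by (rule Mb_integral_const[OF assms(1)])
  finally show ?thesis .
qed

definition cutoff :: "real \<Rightarrow> 'a::euclidean_space \<Rightarrow> real" where
  "cutoff T x = max 0 (min 1 (T + 1 - norm x))"

lemma continuous_cutoff: "continuous_on UNIV (cutoff T)"
  unfolding cutoff_def by (intro continuous_intros)

lemma cutoff_borel [measurable]: "cutoff T \<in> borel_measurable borel"
  by (rule borel_measurable_continuous_onI[OF continuous_cutoff])

lemma cutoff_range: "0 \<le> cutoff T x" "cutoff T x \<le> 1"
  by (simp_all add: cutoff_def)

lemma cutoff_abs: "\<bar>cutoff T x\<bar> \<le> 1"
  by (simp add: cutoff_def)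

lemma cutoff_support: "cutoff T x \<noteq> 0 \<Longrightarrow> norm x \<le> T + 1"
  by (auto simp: cutoff_def split: if_splits)

lemma cutoff_mass_tendsto:
  assumes "M \<in> Mb"
  shows "(\<lambda>n. \<integral>x. cutoff (real n) x \<partial>M) \<longlonglongrightarrow> measure M (UNIV :: 'a::euclidean_space set)"
proof -
  have "(\<lambda>n. \<integral>x. cutoff (real n) x \<partial>M) \<longlonglongrightarrow> (\<integral>x. 1 \<partial>M)"
  proof (rule integral_dominated_convergence[where w="\<lambda>_. 1"])
    show "AE x in M. (\<lambda>n. cutoff (real n) x) \<longlonglongrightarrow> 1"
    proof (intro AE_I2 tendsto_eventually)
      fix x :: 'a
      obtain N where "norm x \<le> real N" using real_arch_simple by blast
      then show "\<forall>\<^sub>F n in sequentially. cutoff (real n) x = 1"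
        by (intro eventually_mono[OF eventually_ge_at_top[of N]]) (auto simp: cutoff_def)
    qed
    show "integrable M (\<lambda>_::'a. 1 :: real)" using assms by (intro Mb_integrable[where B=1]) auto
    show "AE x in M. norm (cutoff (real n) x) \<le> 1" for n by (intro AE_I2) (simp add: cutoff_abs)
  qed (use MbD(2)[OF assms] in \<open>simp_all cong: measurable_cong_sets\<close>)
  then show ?thesis using Mb_integral_const[OF assms, of 1] by simp
qed

lemma integral_cutoff_error:
  fixes f :: "'a::euclidean_space \<Rightarrow> real"
  assumes "M \<in> Mb" "f \<in> borel_measurable borel" "\<And>x. \<bar>f x\<bar> \<le> B"
  shows "\<bar>(\<integral>x. f x \<partial>M) - (\<integral>x. f x * cutoff T x \<partial>M)\<bar> \<le> B * (measure M UNIV - (\<integral>x. cutoff T x \<partial>M))"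
proof -
  have B: "0 \<le> B" using assms(3)[of 0] by linarith
  note [measurable] = assms(2)
  have i: "integrable M (cutoff T)" using assms(1) cutoff_abs by (intro Mb_integrable[where B=1]) auto
  have ifc: "integrable M (\<lambda>x. f x * cutoff T x)"
  proof (rule Mb_integrable[OF assms(1)], measurable)
    show "\<bar>f x * cutoff T x\<bar> \<le> B * 1" for x
      unfolding abs_mult by (intro mult_mono assms(3) cutoff_abs B) simp
  qed
  have if': "integrable M f" by (rule Mb_integrable[OF assms])
  have i1: "integrable M (\<lambda>_. 1 :: real)" using assms(1) by (intro Mb_integrable[where B=1]) auto
  have "\<bar>(\<integral>x. f x \<partial>M) - (\<integral>x. f x * cutoff T x \<partial>M)\<bar> = \<bar>\<integral>x. f x - f x * cutoff T x \<partial>M\<bar>"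
    by (simp add: Bochner_Integration.integral_diff[OF if' ifc])
  also have "\<dots> \<le> (\<integral>x. \<bar>f x - f x * cutoff T x\<bar> \<partial>M)" by (rule integral_abs_bound)
  also have "\<dots> \<le> (\<integral>x. B * (1 - cutoff T x) \<partial>M)"
  proof (intro integral_mono integrable_abs integrable_mult_right Bochner_Integration.integrable_diff i i1 if' ifc)
    fix x
    have "\<bar>f x - f x * cutoff T x\<bar> = \<bar>f x\<bar> * (1 - cutoff T x)"
      using cutoff_range[of T x] by (simp add: abs_mult flip: right_diff_distrib[of "f x" 1, simplified])
    also have "\<dots> \<le> B * (1 - cutoff T x)" using assms(3) cutoff_range by (intro mult_right_mono) auto
    finally show "\<bar>f x - f x * cutoff T x\<bar> \<le> B * (1 - cutoff T x)" .
  qed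
  also have "\<dots> = B * (measure M UNIV - (\<integral>x. cutoff T x \<partial>M))"
    using Mb_integral_const[OF assms(1), of 1] by (simp add: Bochner_Integration.integral_diff[OF i1 i])
  finally show ?thesis .
qed

text \<open>
  Weak-star convergence controls test functions that vanish at infinity, and tightness extends
  this to all bounded continuous ones: after multiplication with a cutoff the error is at most a multiple
  of the mass seen by one minus the cutoff, and convergence of the total masses makes this mass small in
  the limit as well.
\<close>

lemma tight_tendsto_bounded_continuous:
  fixes f :: "'a::euclidean_space \<Rightarrow> real"
  assumes "tight_tendsto \<nu> \<nu>\<^sub>0" "\<forall>\<^sub>F \<epsilon> in at_right 0. \<nu> \<epsilon> \<in> Mb" "\<nu>\<^sub>0 \<in> Mb"
    and "continuous_on UNIV f" "\<And>x. \<bar>f x\<bar> \<le> B"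
  shows "((\<lambda>\<epsilon>. \<integral>x. f x \<partial>\<nu> \<epsilon>) \<longlongrightarrow> (\<integral>x. f x \<partial>\<nu>\<^sub>0)) (at_right 0)"
proof (rule tendstoI)
  fix e :: real assume e: "0 < e"
  have fb: "f \<in> borel_measurable borel" by (rule borel_measurable_continuous_onI[OF assms(4)])
  have weak: "((\<lambda>\<epsilon>. \<integral>x. u x \<partial>\<nu> \<epsilon>) \<longlongrightarrow> (\<integral>x. u x \<partial>\<nu>\<^sub>0)) (at_right 0)"
    if "continuous_on UNIV u" "\<And>x. T + 1 < norm x \<Longrightarrow> u x = 0" for u :: "'a \<Rightarrow> real" and T
  proof -
    have "(u \<longlongrightarrow> 0) at_infinity"
    proof (rule tendsto_eventually)
      show "\<forall>\<^sub>F x in at_infinity. u x = 0"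
        unfolding eventually_at_infinity using that(2) by (intro exI[of _ "T + 2"]) auto
    qed
    then show ?thesis using assms(1) that(1) unfolding tight_tendsto_def weak_star_tendsto_def by blast
  qed
  have mass: "((\<lambda>\<epsilon>. measure (\<nu> \<epsilon>) UNIV) \<longlongrightarrow> measure \<nu>\<^sub>0 UNIV) (at_right 0)"
    using assms(1) unfolding tight_tendsto_def by blast
  have "(\<lambda>n. B * (measure \<nu>\<^sub>0 UNIV - (\<integral>x. cutoff (real n) x \<partial>\<nu>\<^sub>0))) \<longlonglongrightarrow> B * (measure \<nu>\<^sub>0 UNIV - measure \<nu>\<^sub>0 UNIV)"
    by (intro tendsto_intros cutoff_mass_tendsto assms(3))
  then have "\<forall>\<^sub>F n in sequentially. B * (measure \<nu>\<^sub>0 UNIV - (\<integral>x. cutoff (real n) x \<partial>\<nu>\<^sub>0)) < e / 2"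
    by (rule order_tendstoD(2)) (use e in simp)
  then obtain n where n: "B * (measure \<nu>\<^sub>0 UNIV - (\<integral>x. cutoff (real n) x \<partial>\<nu>\<^sub>0)) < e / 2"
    using eventually_happens' by force
  define \<kappa> where "\<kappa> = (cutoff (real n) :: 'a \<Rightarrow> real)"
  define err where "err M = B * (measure M UNIV - (\<integral>x. \<kappa> x \<partial>M))" for M :: "'a measure"
  have c1: "((\<lambda>\<epsilon>. \<integral>x. \<kappa> x \<partial>\<nu> \<epsilon>) \<longlongrightarrow> (\<integral>x. \<kappa> x \<partial>\<nu>\<^sub>0)) (at_right 0)"
    unfolding \<kappa>_def by (rule weak[OF continuous_cutoff, of "real n"]) (use cutoff_support in fastforce)
  have c2: "((\<lambda>\<epsilon>. \<integral>x. f x * \<kappa> x \<partial>\<nu> \<epsilon>) \<longlongrightarrow> (\<integral>x. f x * \<kappa> x \<partial>\<nu>\<^sub>0)) (at_right 0)"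
    unfolding \<kappa>_def by (rule weak[of _ "real n"])
      (use cutoff_support assms(4) continuous_cutoff in \<open>fastforce intro: continuous_on_mult\<close>)+
  have "((\<lambda>\<epsilon>. \<bar>(\<integral>x. f x * \<kappa> x \<partial>\<nu> \<epsilon>) - (\<integral>x. f x * \<kappa> x \<partial>\<nu>\<^sub>0)\<bar> + err (\<nu> \<epsilon>) + err \<nu>\<^sub>0)
      \<longlongrightarrow> \<bar>(\<integral>x. f x * \<kappa> x \<partial>\<nu>\<^sub>0) - (\<integral>x. f x * \<kappa> x \<partial>\<nu>\<^sub>0)\<bar> + err \<nu>\<^sub>0 + err \<nu>\<^sub>0) (at_right 0)"
    unfolding err_def by (intro tendsto_intros c1 c2 mass)
  then have "\<forall>\<^sub>F \<epsilon> in at_right 0. \<bar>(\<integral>x. f x * \<kappa> x \<partial>\<nu> \<epsilon>) - (\<integral>x. f x * \<kappa> x \<partial>\<nu>\<^sub>0)\<bar> + err (\<nu> \<epsilon>) + err \<nu>\<^sub>0 < e"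
    by (rule order_tendstoD(2)) (use n in \<open>simp add: err_def \<kappa>_def\<close>)
  with assms(2) show "\<forall>\<^sub>F \<epsilon> in at_right 0. dist (\<integral>x. f x \<partial>\<nu> \<epsilon>) (\<integral>x. f x \<partial>\<nu>\<^sub>0) < e"
  proof eventually_elim
    case (elim \<epsilon>)
    have "\<bar>(\<integral>x. f x \<partial>M) - (\<integral>x. f x * \<kappa> x \<partial>M)\<bar> \<le> err M" if "M \<in> Mb" for M
      unfolding err_def \<kappa>_def by (rule integral_cutoff_error[OF that fb assms(5)])
    from this[OF elim(1)] this[OF assms(3)] elim(2) show ?case
      unfolding dist_real_def by linarith
  qed
qed

text \<open>
  The modulus of continuity of the convolution depends on the measure only through its total mass;
  hence the convolutions with a convergent family are equicontinuous.
\<close>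

lemma Mb_integral_convolution_diff:
  fixes g :: "'a::euclidean_space \<Rightarrow> real"
  assumes "M \<in> Mb" "continuous_on UNIV g" "\<And>z. \<bar>g z\<bar> \<le> B"
    and "\<And>z z'. dist z' z < \<delta> \<Longrightarrow> \<bar>g z' - g z\<bar> \<le> \<eta>" "dist x' x < \<delta>"
  shows "\<bar>(\<integral>y. g (x' - y) \<partial>M) - (\<integral>y. g (x - y) \<partial>M)\<bar> \<le> \<eta> * measure M UNIV"
proof -
  have m: "(\<lambda>y. g (p - y)) \<in> borel_measurable borel" for p
    by (intro borel_measurable_continuous_onI continuous_on_compose2[OF assms(2)] continuous_intros) auto
  have "(\<integral>y. g (x' - y) \<partial>M) - (\<integral>y. g (x - y) \<partial>M) = (\<integral>y. g (x' - y) - g (x - y) \<partial>M)"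
    by (intro Bochner_Integration.integral_diff[symmetric] Mb_integrable[OF assms(1) m, where B=B] assms(3))
  moreover have "\<bar>\<dots>\<bar> \<le> \<eta> * measure M UNIV"
    using assms(4,5) by (intro Mb_integral_bound[OF assms(1)] borel_measurable_diff m) (auto simp: dist_norm)
  ultimately show ?thesis by simp
qed

lemma continuous_integral_convolution:
  fixes g :: "'a::euclidean_space \<Rightarrow> real"
  assumes "M \<in> Mb" "uniformly_continuous_on UNIV g" "\<And>z. \<bar>g z\<bar> \<le> B"
  shows "continuous_on UNIV (\<lambda>x. \<integral>y. g (x - y) \<partial>M)"
  unfolding continuous_on_iff
proof (intro ballI allI impI)
  fix x :: 'a and e :: real assume e: "0 < e"
  define m where "m = measure M UNIV"
  have m: "0 \<le> m" by (simp add: m_def)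
  obtain \<delta> where d: "0 < \<delta>" "\<And>z z'. dist z' z < \<delta> \<Longrightarrow> dist (g z') (g z) < e / (m + 1)"
    using assms(2) e m unfolding uniformly_continuous_on_def by (metis UNIV_I add_nonneg_pos divide_pos_pos zero_less_one)
  have "dist (\<integral>y. g (x' - y) \<partial>M) (\<integral>y. g (x - y) \<partial>M) < e" if "dist x' x < \<delta>" for x'
  proof -
    have "\<bar>(\<integral>y. g (x' - y) \<partial>M) - (\<integral>y. g (x - y) \<partial>M)\<bar> \<le> e / (m + 1) * measure M UNIV"
      using d(2) by (intro Mb_integral_convolution_diff[OF assms(1) uniformly_continuous_imp_continuous[OF assms(2)] assms(3) _ that])
        (auto simp: dist_real_def less_imp_le)
    also have "\<dots> < e" using e m by (simp add: m_def field_simps add_strict_increasing)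
    finally show ?thesis by (simp add: dist_real_def)
  qed
  then show "\<exists>d>0. \<forall>x'\<in>UNIV. dist x' x < d \<longrightarrow> dist (\<integral>y. g (x' - y) \<partial>M) (\<integral>y. g (x - y) \<partial>M) < e"
    using d(1) by blast
qed

text \<open>
  Let \<open>h\<^sub>\<epsilon>\<close> be the convolution of \<open>g\<close> with \<open>\<nu>\<^sub>\<epsilon>\<close>. Pointwise, \<open>h\<^sub>\<epsilon> \<rightarrow> h\<^sub>0\<close>, because \<open>y \<mapsto> g (x - y)\<close> is
  a bounded continuous test function. Equicontinuity upgrades this to uniform convergence on
  compact sets by way of a finite net, and the part outside a compact set is negligible by tightness.
  Hence the integral of \<open>h\<^sub>\<epsilon> - h\<^sub>0\<close> against \<open>\<nu>\<^sub>\<epsilon>\<close> vanishes in the limit, while \<open>h\<^sub>0\<close> itself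
  is a bounded continuous test function.
\<close>

lemma tight_tendsto_double_integral:
  fixes g :: "'a::euclidean_space \<Rightarrow> real"
  assumes "tight_tendsto \<nu> \<nu>\<^sub>0" "\<forall>\<^sub>F \<epsilon> in at_right 0. \<nu> \<epsilon> \<in> Mb" "\<nu>\<^sub>0 \<in> Mb"
    and "uniformly_continuous_on UNIV g" "\<And>z. \<bar>g z\<bar> \<le> B"
  shows "((\<lambda>\<epsilon>. \<integral>x. \<integral>y. g (x - y) \<partial>\<nu> \<epsilon> \<partial>\<nu> \<epsilon>) \<longlongrightarrow> (\<integral>x. \<integral>y. g (x - y) \<partial>\<nu>\<^sub>0 \<partial>\<nu>\<^sub>0)) (at_right 0)"
proof (rule tendstoI)
  fix e :: real assume e: "0 < e"
  define h where "h M x = (\<integral>y. g (x - y) \<partial>M)" for M and x :: 'a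
  define m where "m = measure \<nu>\<^sub>0 UNIV"
  have m0: "0 \<le> m" by (simp add: m_def)
  have gc: "continuous_on UNIV g" by (rule uniformly_continuous_imp_continuous[OF assms(4)])
  have gpc: "continuous_on UNIV (\<lambda>y. g (p - y))" for p
    by (intro continuous_on_compose2[OF gc] continuous_intros) auto
  have hc: "continuous_on UNIV (h M)" if "M \<in> Mb" for M
    unfolding h_def using continuous_integral_convolution[OF that assms(4,5)] .
  have hb: "\<bar>h M x\<bar> \<le> B * measure M UNIV" if "M \<in> Mb" for M x
    unfolding h_def using Mb_integral_bound[OF that borel_measurable_continuous_onI[OF gpc] assms(5)] .
  have mass: "((\<lambda>\<epsilon>. measure (\<nu> \<epsilon>) UNIV) \<longlongrightarrow> m) (at_right 0)"
    using assms(1) unfolding tight_tendsto_def m_def by blast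
  \<comment> \<open>the net contributes \<open>(2m + 1) m \<eta>\<close> in the limit, where \<open>m\<close> is the total mass\<close>
  define \<eta> where "\<eta> = e / (2 * ((2 * m + 1) * m + 1))"
  have \<eta>: "0 < \<eta>" "\<eta> * ((2 * m + 1) * m) < e / 2"
  proof -
    have "0 \<le> (2 * m + 1) * m" using m0 by simp
    then show "0 < \<eta>" "\<eta> * ((2 * m + 1) * m) < e / 2"
      using e by (simp_all add: \<eta>_def field_simps add_nonneg_pos)
  qed
  have "(\<lambda>n. B * (m + m) * (m - (\<integral>x. cutoff (real n) x \<partial>\<nu>\<^sub>0))) \<longlonglongrightarrow> B * (m + m) * (m - m)"
    unfolding m_def by (intro tendsto_intros cutoff_mass_tendsto assms(3))
  then have "\<forall>\<^sub>F n in sequentially. B * (m + m) * (m - (\<integral>x. cutoff (real n) x \<partial>\<nu>\<^sub>0)) < e / 2"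
    by (rule order_tendstoD(2)) (use e in simp)
  then obtain n where n: "B * (m + m) * (m - (\<integral>x. cutoff (real n) x \<partial>\<nu>\<^sub>0)) < e / 2"
    using eventually_happens' by force
  define \<kappa> where "\<kappa> = (cutoff (real n) :: 'a \<Rightarrow> real)"
  have \<kappa>01: "0 \<le> \<kappa> x" "\<kappa> x \<le> 1" for x using cutoff_range by (auto simp: \<kappa>_def)
  have \<kappa>m: "\<kappa> \<in> borel_measurable borel" by (simp add: \<kappa>_def)
  obtain \<delta> where d: "0 < \<delta>" "\<And>z z'. dist z' z < \<delta> \<Longrightarrow> \<bar>g z' - g z\<bar> \<le> \<eta>"
    using assms(4) \<eta>(1) unfolding uniformly_continuous_on_def dist_real_def by (metis UNIV_I less_imp_le)
  obtain K where K: "finite K" "cball (0::'a) (real n + 1) \<subseteq> (\<Union>p\<in>K. ball p \<delta>)"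
    using compactE_image[OF compact_cball, of "cball (0::'a) (real n + 1)" "\<lambda>p. ball p \<delta>" 0 "real n + 1"] d(1)
    by (metis UN_I centre_in_ball open_ball subsetI)
  have net: "\<forall>\<^sub>F \<epsilon> in at_right 0. \<forall>p\<in>K. \<bar>h (\<nu> \<epsilon>) p - h \<nu>\<^sub>0 p\<bar> < \<eta>"
  proof (intro eventually_ball_finite K(1) ballI)
    fix p
    have "((\<lambda>\<epsilon>. h (\<nu> \<epsilon>) p) \<longlongrightarrow> h \<nu>\<^sub>0 p) (at_right 0)"
      unfolding h_def by (rule tight_tendsto_bounded_continuous[OF assms(1-3) gpc assms(5)])
    then show "\<forall>\<^sub>F \<epsilon> in at_right 0. \<bar>h (\<nu> \<epsilon>) p - h \<nu>\<^sub>0 p\<bar> < \<eta>"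
      using \<eta>(1) unfolding tendsto_iff dist_real_def by blast
  qed
  define R where "R M = \<eta> * ((measure M UNIV + m + 1) * measure M UNIV)
      + B * (measure M UNIV + m) * (measure M UNIV - (\<integral>x. \<kappa> x \<partial>M))
      + \<bar>(\<integral>x. h \<nu>\<^sub>0 x \<partial>M) - (\<integral>x. h \<nu>\<^sub>0 x \<partial>\<nu>\<^sub>0)\<bar>" for M
  have "((\<lambda>\<epsilon>. R (\<nu> \<epsilon>)) \<longlongrightarrow> \<eta> * ((m + m + 1) * m) + B * (m + m) * (m - (\<integral>x. \<kappa> x \<partial>\<nu>\<^sub>0))
      + \<bar>(\<integral>x. h \<nu>\<^sub>0 x \<partial>\<nu>\<^sub>0) - (\<integral>x. h \<nu>\<^sub>0 x \<partial>\<nu>\<^sub>0)\<bar>) (at_right 0)"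
    unfolding R_def
  proof (intro tendsto_intros mass)
    show "((\<lambda>\<epsilon>. \<integral>x. \<kappa> x \<partial>\<nu> \<epsilon>) \<longlongrightarrow> (\<integral>x. \<kappa> x \<partial>\<nu>\<^sub>0)) (at_right 0)"
      by (rule tight_tendsto_bounded_continuous[OF assms(1-3), where B=1])
        (use \<kappa>01 continuous_cutoff in \<open>auto simp: \<kappa>_def\<close>)
    show "((\<lambda>\<epsilon>. \<integral>x. h \<nu>\<^sub>0 x \<partial>\<nu> \<epsilon>) \<longlongrightarrow> (\<integral>x. h \<nu>\<^sub>0 x \<partial>\<nu>\<^sub>0)) (at_right 0)"
      by (rule tight_tendsto_bounded_continuous[OF assms(1-3) hc[OF assms(3)] hb[OF assms(3)]])
  qed
  then have "\<forall>\<^sub>F \<epsilon> in at_right 0. R (\<nu> \<epsilon>) < e"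
  proof (rule order_tendstoD(2))
    have "m + m + 1 = 2 * m + 1" by simp
    then show "\<eta> * ((m + m + 1) * m) + B * (m + m) * (m - (\<integral>x. \<kappa> x \<partial>\<nu>\<^sub>0))
      + \<bar>(\<integral>x. h \<nu>\<^sub>0 x \<partial>\<nu>\<^sub>0) - (\<integral>x. h \<nu>\<^sub>0 x \<partial>\<nu>\<^sub>0)\<bar> < e"
      using \<eta>(2) n unfolding \<kappa>_def by (simp only: diff_self abs_zero)
  qed
  with assms(2) net
  have "\<forall>\<^sub>F \<epsilon> in at_right 0. dist (\<integral>x. h (\<nu> \<epsilon>) x \<partial>\<nu> \<epsilon>) (\<integral>x. h \<nu>\<^sub>0 x \<partial>\<nu>\<^sub>0) < e"
  proof eventually_elim
    case (elim \<epsilon>)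
    define M where "M = \<nu> \<epsilon>"
    define k where "k = measure M UNIV"
    have M: "M \<in> Mb" and k0: "0 \<le> k" using elim(1) by (simp_all add: M_def k_def)
    have near: "\<bar>h M x - h \<nu>\<^sub>0 x\<bar> \<le> \<eta> * (k + m + 1)" if "\<kappa> x \<noteq> 0" for x
    proof -
      have "x \<in> cball 0 (real n + 1)" using cutoff_support that by (auto simp: \<kappa>_def)
      then obtain p where p: "p \<in> K" "dist x p < \<delta>" using K(2) by (auto simp: dist_commute)
      have "\<bar>h M' x - h M' p\<bar> \<le> \<eta> * measure M' UNIV" if "M' \<in> Mb" for M'
        unfolding h_def
        by (rule Mb_integral_convolution_diff[where \<delta>=\<delta>, OF that gc assms(5) _ p(2)]) (rule d(2))
      from this[OF M] this[OF assms(3)]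
      have "\<bar>h M x - h M p\<bar> \<le> \<eta> * k" "\<bar>h \<nu>\<^sub>0 x - h \<nu>\<^sub>0 p\<bar> \<le> \<eta> * m"
        by (simp_all add: k_def m_def)
      moreover have "\<bar>h M p - h \<nu>\<^sub>0 p\<bar> < \<eta>" using elim(2) p(1) by (simp add: M_def)
      ultimately show ?thesis by (simp add: algebra_simps)
    qed
    have far: "\<bar>h M x - h \<nu>\<^sub>0 x\<bar> \<le> B * (k + m)" for x
      using hb[OF M, of x] hb[OF assms(3), of x] by (simp add: k_def m_def algebra_simps)
    have hm: "h M \<in> borel_measurable borel" "h \<nu>\<^sub>0 \<in> borel_measurable borel"
      by (intro borel_measurable_continuous_onI hc M assms(3))+
    note [measurable] = hm \<kappa>m
    have "\<bar>(\<integral>x. h M x - h \<nu>\<^sub>0 x \<partial>M) - (\<integral>x. (h M x - h \<nu>\<^sub>0 x) * \<kappa> x \<partial>M)\<bar>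
        \<le> B * (k + m) * (k - (\<integral>x. \<kappa> x \<partial>M))"
      unfolding k_def \<kappa>_def
      by (rule integral_cutoff_error[OF M]) (use far in \<open>auto simp: k_def\<close>)
    moreover have "\<bar>\<integral>x. (h M x - h \<nu>\<^sub>0 x) * \<kappa> x \<partial>M\<bar> \<le> \<eta> * (k + m + 1) * k"
      unfolding k_def
    proof (rule Mb_integral_bound[OF M], measurable)
      fix x
      show "\<bar>(h M x - h \<nu>\<^sub>0 x) * \<kappa> x\<bar> \<le> \<eta> * (measure M UNIV + m + 1)"
      proof (cases "\<kappa> x = 0")
        case True
        then show ?thesis using \<eta>(1) m0 by simp
      next
        case False
        have "\<bar>(h M x - h \<nu>\<^sub>0 x) * \<kappa> x\<bar> \<le> \<bar>h M x - h \<nu>\<^sub>0 x\<bar> * 1"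
          unfolding abs_mult using \<kappa>01[of x] by (intro mult_left_mono) auto
        then show ?thesis using near[OF False] by (simp add: k_def)
      qed
    qed
    moreover have "(\<integral>x. h M x - h \<nu>\<^sub>0 x \<partial>M) = (\<integral>x. h M x \<partial>M) - (\<integral>x. h \<nu>\<^sub>0 x \<partial>M)"
      by (intro Bochner_Integration.integral_diff Mb_integrable[OF M hm(1) hb[OF M]]
          Mb_integrable[OF M hm(2) hb[OF assms(3)]])
    moreover have "\<eta> * (k + m + 1) * k + B * (k + m) * (k - (\<integral>x. \<kappa> x \<partial>M))
      + \<bar>(\<integral>x. h \<nu>\<^sub>0 x \<partial>M) - (\<integral>x. h \<nu>\<^sub>0 x \<partial>\<nu>\<^sub>0)\<bar> < e"
      using elim(3) unfolding R_def M_def[symmetric] k_def[symmetric] by (simp add: mult.assoc)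
    ultimately show ?case unfolding M_def[symmetric] dist_real_def by linarith
  qed
  then show "\<forall>\<^sub>F \<epsilon> in at_right 0. dist (\<integral>x. \<integral>y. g (x - y) \<partial>\<nu> \<epsilon> \<partial>\<nu> \<epsilon>) (\<integral>x. \<integral>y. g (x - y) \<partial>\<nu>\<^sub>0 \<partial>\<nu>\<^sub>0) < e"
    unfolding h_def .
qed

lemma nn_integral_pair_eq_double_integral:
  fixes g :: "'a::euclidean_space \<Rightarrow> real"
  assumes "M \<in> Mb" "uniformly_continuous_on UNIV g" "\<And>z. \<bar>g z\<bar> \<le> B" "\<And>z. 0 \<le> g z"
  shows "(\<integral>\<^sup>+ (x, y). ennreal (g (x - y)) \<partial>(M \<Otimes>\<^sub>M M)) = ennreal (\<integral>x. \<integral>y. g (x - y) \<partial>M \<partial>M)"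
proof -
  interpret finite_measure M by (rule MbD(1)[OF assms(1)])
  have gc: "continuous_on UNIV g" by (rule uniformly_continuous_imp_continuous[OF assms(2)])
  have [measurable]: "g \<in> borel_measurable borel" by (rule borel_measurable_continuous_onI[OF gc])
  have [measurable_cong]: "sets M = sets borel" by (rule MbD(2)[OF assms(1)])
  have "(\<integral>\<^sup>+ (x, y). ennreal (g (x - y)) \<partial>(M \<Otimes>\<^sub>M M)) = (\<integral>\<^sup>+x. \<integral>\<^sup>+y. ennreal (g (x - y)) \<partial>M \<partial>M)"
    by (subst nn_integral_fst[symmetric]) (auto simp: split_beta')
  also have "\<dots> = (\<integral>\<^sup>+x. ennreal (\<integral>y. g (x - y) \<partial>M) \<partial>M)"
    by (intro nn_integral_cong nn_integral_eq_integral Mb_integrable[OF assms(1), where B=B] AE_I2 assms) measurable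
  also have "\<dots> = ennreal (\<integral>x. \<integral>y. g (x - y) \<partial>M \<partial>M)"
  proof (intro nn_integral_eq_integral Mb_integrable[OF assms(1), where B="B * measure M UNIV"] AE_I2)
    show "(\<lambda>x. \<integral>y. g (x - y) \<partial>M) \<in> borel_measurable borel"
      by (intro borel_measurable_continuous_onI continuous_integral_convolution[OF assms(1-3)])
    show "\<bar>\<integral>y. g (x - y) \<partial>M\<bar> \<le> B * measure M UNIV" for x
      by (intro Mb_integral_bound assms) measurable
    show "0 \<le> (\<integral>y. g (x - y) \<partial>M)" for x by (intro Bochner_Integration.integral_nonneg assms)
  qed
  finally show ?thesis .
qed

section \<open>Energies of atomic measures compared with truncated energies\<close>

text \<open>
  The mass of one atom in the rescaled measure. The unit of mass is such that the optimal packing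
  has density 1: \<open>C\<^sup>d / (\<omega>\<^sub>d \<epsilon>\<^sup>d)\<close> points per unit volume.
\<close>

abbreviation atom_mass :: "'a::euclidean_space itself \<Rightarrow> real \<Rightarrow> real" where
  "atom_mass _ \<epsilon> \<equiv> \<epsilon> ^ DIM('a) * omega TYPE('a) / packing_density TYPE('a)"

lemma atom_mass_pos: "0 < \<epsilon> \<Longrightarrow> 0 < atom_mass TYPE('a::euclidean_space) \<epsilon>"
  using omega_pos[where 'a='a] packing_density_pos[where 'a='a] by simp

lemma atom_mass_tendsto_0: "((\<lambda>\<epsilon>. atom_mass TYPE('a::euclidean_space) \<epsilon>) \<longlongrightarrow> 0) (at_right 0)"
proof -
  have "((\<lambda>\<epsilon>. atom_mass TYPE('a) \<epsilon>) \<longlongrightarrow> 0 ^ DIM('a) * omega TYPE('a) / packing_density TYPE('a)) (at_right 0)"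
    using packing_density_pos[where 'a='a] by (intro tendsto_intros) auto
  then show ?thesis by (simp add: zero_power)
qed

lemma dirac_sum_Mb: "dirac_sum N x \<in> Mb"
proof -
  have "finite_measure (dirac_sum N x)"
    by (rule finite_measureI) (simp add: emeasure_dirac_sum dirac_sum_def[THEN arg_cong[where f=space]])
  then show ?thesis by (simp add: Mb_def dirac_sum_def)
qed

lemma scale_measure_Mb:
  assumes "M \<in> Mb"
  shows "scale_measure (ennreal c) M \<in> Mb"
proof -
  interpret finite_measure M by (rule MbD(1)[OF assms])
  have "finite_measure (scale_measure (ennreal c) M)"
    by (rule finite_measureI) (simp add: space_scale_measure ennreal_mult_eq_top_iff)
  then show ?thesis using MbD(2)[OF assms] by (simp add: Mb_def)
qed

lemma integral_scaled_dirac_sum: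
  fixes f :: "'a::euclidean_space \<Rightarrow> real"
  assumes "0 \<le> c" "f \<in> borel_measurable borel"
  shows "(\<integral>y. f y \<partial>scale_measure (ennreal c) (dirac_sum N x)) = c * (\<Sum>i<N. f (x i))"
proof -
  note [measurable] = assms(2)
  have [measurable_cong]: "sets (dirac_sum N x) = sets borel" by (simp add: dirac_sum_def)
  have "scale_measure (ennreal c) (dirac_sum N x) = density (dirac_sum N x) (\<lambda>_. ennreal c)"
    by (rule measure_eqI) (simp_all add: emeasure_density_const)
  then have "(\<integral>y. f y \<partial>scale_measure (ennreal c) (dirac_sum N x)) = (\<integral>y. c *\<^sub>R f y \<partial>dirac_sum N x)"
    using assms(1) by (simp add: integral_density)
  also have "\<dots> = (\<integral>i. c *\<^sub>R f (x i) \<partial>count_space {..<N})"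
    unfolding dirac_sum_def by (rule integral_distr) auto
  also have "\<dots> = c * (\<Sum>i<N. f (x i))"
    by (simp add: lebesgue_integral_count_space_finite sum_distrib_left)
  finally show ?thesis .
qed

lemma measure_scaled_dirac_sum:
  "0 \<le> c \<Longrightarrow> measure (scale_measure (ennreal c) (dirac_sum N x)) UNIV = c * N"
  using Mb_integral_const[OF scale_measure_Mb[OF dirac_sum_Mb], of c N x 1]
    integral_scaled_dirac_sum[of c "\<lambda>_. 1" N x]
  by (simp add: space_scale_measure MbD(3)[OF dirac_sum_Mb])

lemma double_integral_scaled_dirac_sum:
  fixes g :: "'a::euclidean_space \<Rightarrow> real"
  assumes "0 \<le> c" "continuous_on UNIV g"
  defines "M x N \<equiv> scale_measure (ennreal c) (dirac_sum N x)"
  shows "(\<integral>y. \<integral>z. g (y - z) \<partial>M x N \<partial>M x N) = c\<^sup>2 * (\<Sum>i<N. \<Sum>j<N. g (x i - x j))"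
proof -
  have [measurable]: "g \<in> borel_measurable borel" by (rule borel_measurable_continuous_onI[OF assms(2)])
  have "(\<integral>z. g (y - z) \<partial>M x N) = c * (\<Sum>j<N. g (y - x j))" for y
    unfolding M_def by (intro integral_scaled_dirac_sum assms(1)) measurable
  then show ?thesis
    unfolding M_def by (simp add: integral_scaled_dirac_sum assms(1) sum_distrib_left power2_eq_square mult.assoc)
qed

lemma point_energy_eq:
  fixes x :: "nat \<Rightarrow> 'a::euclidean_space"
  shows "point_energy \<sigma> \<epsilon> N x =
    - ((atom_mass TYPE('a) \<epsilon>)\<^sup>2 * (\<Sum>i<N. \<Sum>j\<in>{..<N} - {i}. riesz_kernel (real DIM('a) + \<sigma>) (x i - x j)))"
  unfolding point_energy_def riesz_kernel_def dist_norm
  by (simp add: sum_distrib_left sum_negf mult.commute)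

lemma separated_distinct:
  assumes "0 < \<epsilon>" "separated \<epsilon> N x" "i < N" "j < N" "i \<noteq> j"
  shows "x i - x j \<noteq> 0"
proof
  assume "x i - x j = 0"
  moreover have "2 * \<epsilon> \<le> dist (x i) (x j)" using assms(2-5) unfolding separated_def by blast
  ultimately show False using assms(1) by simp
qed

text \<open>
  Off the diagonal the kernel dominates its truncation. The last summand is the contribution of the
  diagonal to the truncated double integral, to which all \<open>N\<close> points contribute equally.
\<close>

lemma point_energy_le:
  fixes x :: "nat \<Rightarrow> 'a::euclidean_space"
  assumes "0 < \<epsilon>" "separated \<epsilon> N x" "0 < s" "s = real DIM('a) + \<sigma>" "0 < r"
  defines "M \<equiv> scale_measure (ennreal (atom_mass TYPE('a) \<epsilon>)) (dirac_sum N x)"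
  shows "point_energy \<sigma> \<epsilon> N x \<le>
    - (\<integral>y. \<integral>z. truncated_kernel s r (y - z) \<partial>M \<partial>M) + atom_mass TYPE('a) \<epsilon> * (1 / r powr s) * measure M UNIV"
proof -
  define w where "w = atom_mass TYPE('a) \<epsilon>"
  have l: "0 \<le> w" using atom_mass_pos[OF assms(1), where 'a='a] by (simp add: w_def)
  have "(\<Sum>j<N. truncated_kernel s r (x i - x j)) - 1 / r powr s \<le> (\<Sum>j\<in>{..<N} - {i}. riesz_kernel s (x i - x j))"
    if i: "i < N" for i
  proof -
    have "(\<Sum>j<N. truncated_kernel s r (x i - x j))
        = truncated_kernel s r (x i - x i) + (\<Sum>j\<in>{..<N} - {i}. truncated_kernel s r (x i - x j))"
      using i by (intro sum.remove) auto
    moreover have "(\<Sum>j\<in>{..<N} - {i}. truncated_kernel s r (x i - x j)) \<le> (\<Sum>j\<in>{..<N} - {i}. riesz_kernel s (x i - x j))"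
      using i assms by (intro sum_mono truncated_kernel_le_riesz separated_distinct[OF assms(1,2)]) auto
    moreover have "truncated_kernel s r (x i - x i) \<le> 1 / r powr s"
      using assms by (intro truncated_kernel_le) auto
    ultimately show ?thesis by linarith
  qed
  then have "(\<Sum>i<N. (\<Sum>j<N. truncated_kernel s r (x i - x j)) - 1 / r powr s)
      \<le> (\<Sum>i<N. \<Sum>j\<in>{..<N} - {i}. riesz_kernel s (x i - x j))"
    by (intro sum_mono) auto
  then have "w\<^sup>2 * (\<Sum>i<N. (\<Sum>j<N. truncated_kernel s r (x i - x j)) - 1 / r powr s)
      \<le> w\<^sup>2 * (\<Sum>i<N. \<Sum>j\<in>{..<N} - {i}. riesz_kernel s (x i - x j))"
    by (rule mult_left_mono) simp
  moreover have "w\<^sup>2 * (\<Sum>i<N. (\<Sum>j<N. truncated_kernel s r (x i - x j)) - 1 / r powr s) =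
      (\<integral>y. \<integral>z. truncated_kernel s r (y - z) \<partial>M \<partial>M) - w * (1 / r powr s) * measure M UNIV"
    unfolding M_def w_def[symmetric] measure_scaled_dirac_sum[OF l]
      double_integral_scaled_dirac_sum[OF l continuous_truncated_kernel[OF assms(5)]]
    by (simp add: sum_subtractf right_diff_distrib power2_eq_square)
  ultimately show ?thesis
    unfolding point_energy_eq assms(4)[symmetric] w_def[symmetric] by linarith
qed

text \<open>
  At distance at least \<open>r\<close> the kernel and its truncation agree, and the nearby pairs are
  controlled by the local integral of the kernel. That estimate carries the factor \<open>\<omega>\<^sub>d \<epsilon>\<^sup>d\<close>, which is
  \<open>C\<^sup>d\<close> times the mass of an atom; this is where \<open>c / C\<^sup>d\<close> comes from.
\<close>

lemma point_energy_ge: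
  fixes x :: "nat \<Rightarrow> 'a::euclidean_space"
  assumes "0 < \<epsilon>" "separated \<epsilon> N x" "0 < s" "s = real DIM('a) + \<sigma>" "0 < r" "0 \<le> c"
    and c: "ennreal ((3 / 2) powr s) * (\<integral>\<^sup>+y\<in>ball (0::'a) (3 / 2 * r). riesz_kernel s y \<partial>lborel) \<le> ennreal c"
  defines "M \<equiv> scale_measure (ennreal (atom_mass TYPE('a) \<epsilon>)) (dirac_sum N x)"
  shows "- (\<integral>y. \<integral>z. truncated_kernel s r (y - z) \<partial>M \<partial>M) - c / packing_density TYPE('a) * measure M UNIV
    \<le> point_energy \<sigma> \<epsilon> N x"
proof -
  define w where "w = atom_mass TYPE('a) \<epsilon>"
  have l: "0 \<le> w" using atom_mass_pos[OF assms(1), where 'a='a] by (simp add: w_def)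
  define J where "J i = {j. j < N \<and> j \<noteq> i \<and> dist (x i) (x j) < r}" for i
  have J: "finite (J i)" "J i \<subseteq> {..<N} - {i}" for i by (auto simp: J_def)
  have "w * (\<Sum>j\<in>{..<N} - {i}. riesz_kernel s (x i - x j))
      \<le> w * (\<Sum>j<N. truncated_kernel s r (x i - x j)) + c / packing_density TYPE('a)"
    if i: "i < N" for i
  proof -
    have "(\<Sum>j\<in>J i. ennreal (omega TYPE('a) * \<epsilon> ^ DIM('a) * riesz_kernel s (x i - x j))) \<le> ennreal c"
      using order_trans[OF sum_riesz_kernel_near[OF assms(1,2) i assms(3)] c] unfolding J_def .
    moreover have "0 \<le> omega TYPE('a) * \<epsilon> ^ DIM('a)" using assms(1) omega_pos[where 'a='a] by simp
    ultimately have "(\<Sum>j\<in>J i. omega TYPE('a) * \<epsilon> ^ DIM('a) * riesz_kernel s (x i - x j)) \<le> c"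
      using assms(6) by (subst (asm) sum_ennreal) (auto intro!: mult_nonneg_nonneg riesz_kernel_nonneg)
    then have "(\<Sum>j\<in>J i. omega TYPE('a) * \<epsilon> ^ DIM('a) * riesz_kernel s (x i - x j)) / packing_density TYPE('a)
        \<le> c / packing_density TYPE('a)"
      using packing_density_pos[where 'a='a] by (intro divide_right_mono) auto
    then have near: "w * (\<Sum>j\<in>J i. riesz_kernel s (x i - x j)) \<le> c / packing_density TYPE('a)"
      by (simp add: w_def sum_distrib_left sum_divide_distrib mult.commute)
    have "(\<Sum>j\<in>{..<N} - {i} - J i. riesz_kernel s (x i - x j)) = (\<Sum>j\<in>{..<N} - {i} - J i. truncated_kernel s r (x i - x j))"
      by (intro sum.cong refl truncated_kernel_eq[symmetric]) (auto simp: J_def dist_norm)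
    also have "\<dots> \<le> (\<Sum>j<N. truncated_kernel s r (x i - x j))"
      by (intro sum_mono2 truncated_kernel_nonneg) auto
    finally have "(\<Sum>j\<in>{..<N} - {i}. riesz_kernel s (x i - x j))
        \<le> (\<Sum>j<N. truncated_kernel s r (x i - x j)) + (\<Sum>j\<in>J i. riesz_kernel s (x i - x j))"
      using sum.subset_diff[OF J(2)[of i], of "\<lambda>j. riesz_kernel s (x i - x j)"] by simp
    from mult_left_mono[OF this l] near show ?thesis unfolding distrib_left by linarith
  qed
  then have "(\<Sum>i<N. w * (\<Sum>j\<in>{..<N} - {i}. riesz_kernel s (x i - x j)))
      \<le> (\<Sum>i<N. w * (\<Sum>j<N. truncated_kernel s r (x i - x j)) + c / packing_density TYPE('a))"
    by (intro sum_mono) auto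
  then have "w * (\<Sum>i<N. w * (\<Sum>j\<in>{..<N} - {i}. riesz_kernel s (x i - x j)))
      \<le> w * (\<Sum>i<N. w * (\<Sum>j<N. truncated_kernel s r (x i - x j)) + c / packing_density TYPE('a))"
    by (rule mult_left_mono[OF _ l])
  moreover have "w * (\<Sum>i<N. w * (\<Sum>j<N. truncated_kernel s r (x i - x j)) + c / packing_density TYPE('a)) =
      (\<integral>y. \<integral>z. truncated_kernel s r (y - z) \<partial>M \<partial>M) + c / packing_density TYPE('a) * measure M UNIV"
    unfolding M_def w_def[symmetric] measure_scaled_dirac_sum[OF l]
      double_integral_scaled_dirac_sum[OF l continuous_truncated_kernel[OF assms(5)]]
    by (simp add: sum.distrib distrib_left power2_eq_square mult.assoc flip: sum_distrib_left)
  moreover have "w * (\<Sum>i<N. w * (\<Sum>j\<in>{..<N} - {i}. riesz_kernel s (x i - x j)))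
      = w\<^sup>2 * (\<Sum>i<N. \<Sum>j\<in>{..<N} - {i}. riesz_kernel s (x i - x j))"
    by (simp add: power2_eq_square mult.assoc flip: sum_distrib_left)
  ultimately show ?thesis
    unfolding point_energy_eq assms(4)[symmetric] w_def[symmetric] by linarith
qed

lemma with_density_Mb:
  assumes "\<rho> \<in> L1_unit"
  shows "with_density \<rho> \<in> Mb"
proof -
  have i: "integrable lborel \<rho>" using assms by (simp add: L1_unit_def)
  have "finite_measure (with_density \<rho>)"
  proof (rule finite_measureI)
    have "emeasure (with_density \<rho>) UNIV = (\<integral>\<^sup>+x. ennreal (\<rho> x) \<partial>lborel)"
      using i by (subst emeasure_density) auto
    also have "\<dots> \<le> (\<integral>\<^sup>+x. ennreal (norm (\<rho> x)) \<partial>lborel)" by (intro nn_integral_mono ennreal_leI) simp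
    also have "\<dots> < \<infinity>" using i unfolding integrable_iff_bounded by blast
    finally show "emeasure (with_density \<rho>) (space (with_density \<rho>)) \<noteq> \<infinity>" by simp
  qed
  then show ?thesis by (simp add: Mb_def)
qed

lemma with_density_le_lborel:
  assumes "\<rho> \<in> L1_unit"
  shows "with_density \<rho> \<le> lborel"
proof -
  have [measurable]: "\<rho> \<in> borel_measurable borel" and b: "AE x in lborel. \<rho> x \<in> {0..1}"
    using assms by (auto simp: L1_unit_def)
  have "emeasure (with_density \<rho>) A \<le> emeasure lborel A" for A
  proof (cases "A \<in> sets lborel")
    case True
    then have "emeasure (with_density \<rho>) A = (\<integral>\<^sup>+x. ennreal (\<rho> x) * indicator A x \<partial>lborel)"
      by (subst emeasure_density) auto
    also have "\<dots> \<le> (\<integral>\<^sup>+x. indicator A x \<partial>lborel)"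
      by (rule nn_integral_mono_AE, use b in eventually_elim) (auto simp: indicator_def)
    finally show ?thesis using True by simp
  next
    case False
    then show ?thesis by (simp add: emeasure_notin_sets)
  qed
  then show ?thesis by (simp add: le_measure_iff le_fun_def)
qed

lemma limit_energy_eq:
  fixes M :: "'a::euclidean_space measure"
  assumes "M \<le> lborel" "s = real DIM('a) + \<sigma>"
  shows "limit_energy \<sigma> M = - enn2ereal (\<integral>\<^sup>+ (x, y). ennreal (riesz_kernel s (x - y)) \<partial>(M \<Otimes>\<^sub>M M))"
  using assms by (simp add: limit_energy_def riesz_kernel_def dist_norm)

text \<open>
  The kernel has the value 0 on the diagonal, where the inequality between the kernels
  fails; the diagonal is negligible because the measure has no atoms.
\<close>

lemma truncated_energy_le_riesz_energy:
  fixes M :: "'a::euclidean_space measure"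
  assumes "M \<in> Mb" "\<And>x. emeasure M {x} = 0" "0 < r" "0 < s"
  shows "ennreal (\<integral>x. \<integral>y. truncated_kernel s r (x - y) \<partial>M \<partial>M)
    \<le> (\<integral>\<^sup>+ (x, y). ennreal (riesz_kernel s (x - y)) \<partial>(M \<Otimes>\<^sub>M M))"
proof -
  interpret finite_measure M by (rule MbD(1)[OF assms(1)])
  have [measurable_cong]: "sets M = sets borel" by (rule MbD(2)[OF assms(1)])
  have [measurable]: "truncated_kernel s r \<in> borel_measurable (borel :: 'a measure)"
    by (rule borel_measurable_continuous_onI[OF continuous_truncated_kernel[OF assms(3)]])
  have "ennreal (\<integral>x. \<integral>y. truncated_kernel s r (x - y) \<partial>M \<partial>M)
      = (\<integral>\<^sup>+ (x, y). ennreal (truncated_kernel s r (x - y)) \<partial>(M \<Otimes>\<^sub>M M))"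
    using assms truncated_kernel_le[of r s] truncated_kernel_nonneg[of s r]
    by (intro nn_integral_pair_eq_double_integral[symmetric, where B="1 / r powr s"] uniformly_continuous_truncated_kernel) auto
  also have "\<dots> = (\<integral>\<^sup>+x. \<integral>\<^sup>+y. ennreal (truncated_kernel s r (x - y)) \<partial>M \<partial>M)"
    by (subst nn_integral_fst[symmetric]) (auto simp: split_beta')
  also have "\<dots> \<le> (\<integral>\<^sup>+x. \<integral>\<^sup>+y. ennreal (riesz_kernel s (x - y)) \<partial>M \<partial>M)"
  proof (rule nn_integral_mono, rule nn_integral_mono_AE)
    fix x
    have "AE y in M. y \<noteq> x"
      by (rule AE_I[where N="{x}"]) (use assms(2) in auto)
    then show "AE y in M. ennreal (truncated_kernel s r (x - y)) \<le> ennreal (riesz_kernel s (x - y))"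
    proof eventually_elim
      case (elim y)
      then show ?case using assms(3,4) by (intro ennreal_leI truncated_kernel_le_riesz) auto
    qed
  qed
  also have "\<dots> = (\<integral>\<^sup>+ (x, y). ennreal (riesz_kernel s (x - y)) \<partial>(M \<Otimes>\<^sub>M M))"
    by (subst nn_integral_fst[symmetric]) (auto simp: split_beta')
  finally show ?thesis .
qed

text \<open>
  Fatou's lemma along \<open>r = 1/(n+1)\<close>. The untruncated kernel lies below the limit of the
  truncated ones also on the diagonal, where it has the value 0.
\<close>

lemma riesz_energy_le_truncated_bound:
  fixes M :: "'a::euclidean_space measure"
  assumes "M \<in> Mb" "0 < s" "\<And>r. 0 < r \<Longrightarrow> (\<integral>x. \<integral>y. truncated_kernel s r (x - y) \<partial>M \<partial>M) \<le> b"
  shows "(\<integral>\<^sup>+ (x, y). ennreal (riesz_kernel s (x - y)) \<partial>(M \<Otimes>\<^sub>M M)) \<le> ennreal b"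
proof -
  define k where "k n = (truncated_kernel s (1 / Suc n) :: 'a \<Rightarrow> real)" for n
  have [measurable_cong]: "sets M = sets borel" by (rule MbD(2)[OF assms(1)])
  have [measurable]: "k n \<in> borel_measurable borel" for n
    unfolding k_def by (intro borel_measurable_continuous_onI continuous_truncated_kernel) simp
  have k_ge: "riesz_kernel s z \<le> k n z" if "norm z \<ge> 1 / Suc n \<or> z = 0" for z n
    using that truncated_kernel_nonneg[of s] by (auto simp: k_def truncated_kernel_eq) (simp add: riesz_kernel_def)
  have le: "ennreal (riesz_kernel s z) \<le> liminf (\<lambda>n. ennreal (k n z))" for z
  proof (intro Liminf_bounded)
    obtain n where n: "norm z \<ge> 1 / Suc n \<or> z = 0"
      using nat_approx_posE[of "norm z"] by (metis less_imp_le zero_less_norm_iff)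
    show "\<forall>\<^sub>F n in sequentially. ennreal (riesz_kernel s z) \<le> ennreal (k n z)"
    proof (intro eventually_mono[OF eventually_ge_at_top[of n]] ennreal_leI k_ge)
      fix m assume "n \<le> m"
      then have "1 / real (Suc m) \<le> 1 / real (Suc n)" by (intro divide_left_mono) auto
      then show "1 / real (Suc m) \<le> norm z \<or> z = 0" using n by linarith
    qed
  qed
  have "(\<integral>\<^sup>+ (x, y). ennreal (riesz_kernel s (x - y)) \<partial>(M \<Otimes>\<^sub>M M))
      \<le> (\<integral>\<^sup>+ p. liminf (\<lambda>n. ennreal (k n (fst p - snd p))) \<partial>(M \<Otimes>\<^sub>M M))"
    by (intro nn_integral_mono) (use le in \<open>auto simp: split_beta'\<close>)
  also have "\<dots> \<le> liminf (\<lambda>n. \<integral>\<^sup>+ p. ennreal (k n (fst p - snd p)) \<partial>(M \<Otimes>\<^sub>M M))"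
    by (rule nn_integral_liminf) measurable
  also have "\<dots> \<le> liminf (\<lambda>n. ennreal b)"
  proof (intro Liminf_mono always_eventually allI)
    fix n
    have "(\<integral>\<^sup>+ (x, y). ennreal (k n (x - y)) \<partial>(M \<Otimes>\<^sub>M M)) = ennreal (\<integral>x. \<integral>y. k n (x - y) \<partial>M \<partial>M)"
      unfolding k_def
    proof (rule nn_integral_pair_eq_double_integral[OF assms(1)])
      show "uniformly_continuous_on UNIV (truncated_kernel s (1 / real (Suc n)) :: 'a \<Rightarrow> real)"
        by (rule uniformly_continuous_truncated_kernel) (use assms(2) in simp_all)
      show "\<bar>truncated_kernel s (1 / real (Suc n)) z\<bar> \<le> 1 / (1 / real (Suc n)) powr s" for z :: 'a
        using truncated_kernel_le[of "1 / real (Suc n)" s z] truncated_kernel_nonneg[of s "1 / real (Suc n)" z] assms(2)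
        by simp
    qed (rule truncated_kernel_nonneg)
    also have "\<dots> \<le> ennreal b" unfolding k_def by (intro ennreal_leI assms(3)) simp
    finally show "(\<integral>\<^sup>+ p. ennreal (k n (fst p - snd p)) \<partial>(M \<Otimes>\<^sub>M M)) \<le> ennreal b"
      by (simp only: split_beta')
  qed
  finally show ?thesis by (simp add: Liminf_const)
qed

section \<open>Both energy inequalities for a given family\<close>

lemma emeasure_with_density_singleton:
  assumes "\<rho> \<in> L1_unit"
  shows "emeasure (with_density \<rho>) {x} = 0"
proof -
  have "emeasure (with_density \<rho>) \<le> emeasure lborel"
    using with_density_le_lborel[OF assms] by (simp add: le_measure_iff)
  then have "emeasure (with_density \<rho>) {x} \<le> emeasure lborel {x}" by (rule le_funD)
  also have "\<dots> = 0" by (rule emeasure_lborel_singleton)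
  finally show ?thesis by (simp only: le_zero_eq)
qed

lemma tendsto_truncated_energy:
  fixes \<mu> :: "real \<Rightarrow> 'a::euclidean_space measure"
  assumes "\<forall>\<epsilon>\<in>{0<..<1}. \<mu> \<epsilon> \<in> Mb" "\<nu>\<^sub>0 \<in> Mb" "tight_tendsto (rescaled \<mu>) \<nu>\<^sub>0" "0 < r" "0 < s"
  shows "((\<lambda>\<epsilon>. \<integral>x. \<integral>y. truncated_kernel s r (x - y) \<partial>rescaled \<mu> \<epsilon> \<partial>rescaled \<mu> \<epsilon>)
    \<longlongrightarrow> (\<integral>x. \<integral>y. truncated_kernel s r (x - y) \<partial>\<nu>\<^sub>0 \<partial>\<nu>\<^sub>0)) (at_right 0)"
proof (rule tight_tendsto_double_integral[OF assms(3) _ assms(2)])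
  show "\<forall>\<^sub>F \<epsilon> in at_right 0. rescaled \<mu> \<epsilon> \<in> Mb"
    using assms(1) unfolding eventually_at_right_field rescaled_def
    by (intro exI[of _ 1]) (auto intro: scale_measure_Mb)
  show "uniformly_continuous_on UNIV (truncated_kernel s r :: 'a \<Rightarrow> real)"
    by (rule uniformly_continuous_truncated_kernel[OF assms(4,5)])
  show "\<bar>truncated_kernel s r z\<bar> \<le> 1 / r powr s" for z :: 'a
    using truncated_kernel_le[of r s z] truncated_kernel_nonneg[of s r z] assms(4,5) by simp
qed

text \<open>
  The loss in the near-diagonal estimate is \<open>c / C\<^sup>d\<close> per unit of mass, where \<open>c\<close> can be made arbitrarily
  small by decreasing \<open>r\<close>. If \<open>\<mu> \<epsilon>\<close> is not a sum of separated Dirac masses, its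
  energy is infinite and the inequality is trivial.
\<close>

lemma discrete_energy_liminf:
  fixes \<mu> :: "real \<Rightarrow> 'a::euclidean_space measure"
  assumes "- real DIM('a) < \<sigma>" "\<sigma> < 0" and \<rho>: "\<rho> \<in> L1_unit"
    and Mb: "\<forall>\<epsilon>\<in>{0<..<1}. \<mu> \<epsilon> \<in> Mb" and tight: "tight_tendsto (rescaled \<mu>) (with_density \<rho>)"
  shows "limit_energy \<sigma> (with_density \<rho>) \<le> Liminf (at_right 0) (\<lambda>\<epsilon>. discrete_energy \<sigma> \<epsilon> (\<mu> \<epsilon>))"
proof (rule ereal_le_epsilon2)
  fix e :: real assume e: "0 < e"
  define s where "s = real DIM('a) + \<sigma>"
  have s: "0 < s" "s < real DIM('a)" using assms(1,2) by (auto simp: s_def)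
  define C where "C = packing_density TYPE('a)"
  have C: "0 < C" unfolding C_def by (rule packing_density_pos)
  define m where "m = measure (with_density \<rho>) (UNIV :: 'a set)"
  have m: "0 \<le> m" by (simp add: m_def)
  \<comment> \<open>the loss is \<open>c / C\<close> per unit of mass, hence at most \<open>e\<close> in total\<close>
  define c where "c = e * C / (m + 1)"
  have c: "0 < c" "c / C * m \<le> e"
  proof -
    show "0 < c" using e C m by (simp add: c_def)
    have "c / C * m = e * (m / (m + 1))" using C by (simp add: c_def)
    also have "\<dots> \<le> e * 1" using e m by (intro mult_left_mono) auto
    finally show "c / C * m \<le> e" by simp
  qed
  obtain r\<^sub>0 where r0: "0 < r\<^sub>0"
    "(\<integral>\<^sup>+y\<in>ball (0::'a) r\<^sub>0. riesz_kernel s y \<partial>lborel) < ennreal (c / (3 / 2) powr s)"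
    using riesz_kernel_small_ball[OF s, of "ennreal (c / (3 / 2) powr s)"] c(1) by auto
  define r where "r = 2 / 3 * r\<^sub>0"
  have r: "0 < r" "3 / 2 * r = r\<^sub>0" using r0(1) by (simp_all add: r_def)
  have near: "ennreal ((3 / 2) powr s) * (\<integral>\<^sup>+y\<in>ball (0::'a) (3 / 2 * r). riesz_kernel s y \<partial>lborel) \<le> ennreal c"
  proof -
    have "ennreal ((3 / 2) powr s) * (\<integral>\<^sup>+y\<in>ball (0::'a) r\<^sub>0. riesz_kernel s y \<partial>lborel)
        \<le> ennreal ((3 / 2) powr s) * ennreal (c / (3 / 2) powr s)"
      using r0(2) by (intro mult_left_mono) auto
    also have "\<dots> = ennreal ((3 / 2) powr s * (c / (3 / 2) powr s))"
      by (rule ennreal_mult'[symmetric]) simp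
    also have "(3 / 2) powr s * (c / (3 / 2) powr s) = c"
      by simp
    finally show ?thesis unfolding r(2) .
  qed
  define I where "I M = (\<integral>x. \<integral>y. truncated_kernel s r (x - y) \<partial>M \<partial>M)" for M :: "'a measure"
  define L where "L \<epsilon> = - I (rescaled \<mu> \<epsilon>) - c / C * measure (rescaled \<mu> \<epsilon>) UNIV" for \<epsilon>
  have "(L \<longlongrightarrow> - I (with_density \<rho>) - c / C * m) (at_right 0)"
    unfolding L_def I_def m_def using tight
    by (intro tendsto_intros tendsto_truncated_energy[OF Mb with_density_Mb[OF \<rho>] tight r(1) s(1)])
      (auto simp: tight_tendsto_def)
  then have "ereal (- I (with_density \<rho>) - c / C * m) = Liminf (at_right 0) (\<lambda>\<epsilon>. ereal (L \<epsilon>))"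
    by (intro lim_imp_Liminf[symmetric]) auto
  also have "\<dots> \<le> Liminf (at_right 0) (\<lambda>\<epsilon>. discrete_energy \<sigma> \<epsilon> (\<mu> \<epsilon>))"
  proof (rule Liminf_mono)
    have "ereal (L \<epsilon>) \<le> discrete_energy \<sigma> \<epsilon> (\<mu> \<epsilon>)" if pos: "0 < \<epsilon>" for \<epsilon>
    proof (cases "\<mu> \<epsilon> \<in> EM \<epsilon>")
      case True
      then obtain N x where x: "\<mu> \<epsilon> = dirac_sum N x" "separated \<epsilon> N x" unfolding EM_def by blast
      have "L \<epsilon> \<le> point_energy \<sigma> \<epsilon> N x"
        unfolding L_def I_def rescaled_def x(1) C_def
        by (rule point_energy_ge[OF pos x(2) s(1) s_def r(1) less_imp_le[OF c(1)] near])
      then show ?thesis by (simp add: x discrete_energy_dirac_sum[OF pos])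
    next
      case False
      then show ?thesis by (simp add: discrete_energy_def)
    qed
    then show "\<forall>\<^sub>F \<epsilon> in at_right 0. ereal (L \<epsilon>) \<le> discrete_energy \<sigma> \<epsilon> (\<mu> \<epsilon>)"
      unfolding eventually_at_right_field by (intro exI[of _ 1]) auto
  qed
  finally have "ereal (- I (with_density \<rho>) - c / C * m) + ereal e
      \<le> Liminf (at_right 0) (\<lambda>\<epsilon>. discrete_energy \<sigma> \<epsilon> (\<mu> \<epsilon>)) + ereal e"
    by (rule add_right_mono)
  moreover have "limit_energy \<sigma> (with_density \<rho>) \<le> ereal (- I (with_density \<rho>))"
  proof -
    have "ennreal (I (with_density \<rho>)) \<le>
        (\<integral>\<^sup>+ (x, y). ennreal (riesz_kernel s (x - y)) \<partial>(with_density \<rho> \<Otimes>\<^sub>M with_density \<rho>))"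
      unfolding I_def
      by (rule truncated_energy_le_riesz_energy[OF with_density_Mb[OF \<rho>] emeasure_with_density_singleton[OF \<rho>] r(1) s(1)])
    then have "enn2ereal (ennreal (I (with_density \<rho>))) \<le>
        enn2ereal (\<integral>\<^sup>+ (x, y). ennreal (riesz_kernel s (x - y)) \<partial>(with_density \<rho> \<Otimes>\<^sub>M with_density \<rho>))"
      by (simp only: less_eq_ennreal.rep_eq)
    moreover have "0 \<le> I (with_density \<rho>)"
      unfolding I_def by (intro Bochner_Integration.integral_nonneg truncated_kernel_nonneg)
    ultimately show ?thesis
      unfolding limit_energy_eq[OF with_density_le_lborel[OF \<rho>] s_def]
      by (simp add: enn2ereal_ennreal flip: uminus_ereal.simps(1))
  qed
  moreover have "ereal (- I (with_density \<rho>)) \<le> ereal (- I (with_density \<rho>) - c / C * m) + ereal e"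
    using c(2) by simp
  ultimately show "limit_energy \<sigma> (with_density \<rho>) \<le> Liminf (at_right 0) (\<lambda>\<epsilon>. discrete_energy \<sigma> \<epsilon> (\<mu> \<epsilon>)) + ereal e"
    by (meson order_trans)
qed

text \<open>
  For fixed \<open>r\<close> the energies are bounded above by minus the truncated double integrals, up to a diagonal term
  proportional to the mass of an atom. Letting \<open>\<epsilon> \<rightarrow> 0\<close> and then \<open>r \<rightarrow> 0\<close> recovers the full kernel.
\<close>

lemma discrete_energy_limsup:
  fixes \<mu> :: "real \<Rightarrow> 'a::euclidean_space measure"
  assumes "- real DIM('a) < \<sigma>" and \<rho>: "\<rho> \<in> L1_unit"
    and Mb: "\<forall>\<epsilon>\<in>{0<..<1}. \<mu> \<epsilon> \<in> Mb" and tight: "tight_tendsto (rescaled \<mu>) (with_density \<rho>)"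
    and EM: "\<forall>\<^sub>F \<epsilon> in at_right 0. \<mu> \<epsilon> \<in> EM \<epsilon>"
  shows "Limsup (at_right 0) (\<lambda>\<epsilon>. discrete_energy \<sigma> \<epsilon> (\<mu> \<epsilon>)) \<le> limit_energy \<sigma> (with_density \<rho>)"
proof -
  define s where "s = real DIM('a) + \<sigma>"
  have s: "0 < s" using assms(1) by (auto simp: s_def)
  define I where "I r M = (\<integral>x. \<integral>y. truncated_kernel s r (x - y) \<partial>M \<partial>M)" for r and M :: "'a measure"
  define F where "F = Limsup (at_right 0) (\<lambda>\<epsilon>. discrete_energy \<sigma> \<epsilon> (\<mu> \<epsilon>))"
  have le: "F \<le> ereal (- I r (with_density \<rho>))" if r: "0 < r" for r
  proof -
    define U where "U \<epsilon> = - I r (rescaled \<mu> \<epsilon>) + atom_mass TYPE('a) \<epsilon> * (1 / r powr s) * measure (rescaled \<mu> \<epsilon>) UNIV" for \<epsilon>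
    have "(U \<longlongrightarrow> - I r (with_density \<rho>) + 0 * (1 / r powr s) * measure (with_density \<rho>) UNIV) (at_right 0)"
      unfolding U_def I_def using tight
      by (intro tendsto_add tendsto_minus tendsto_mult tendsto_const atom_mass_tendsto_0
          tendsto_truncated_energy[OF Mb with_density_Mb[OF \<rho>] tight r s])
        (auto simp: tight_tendsto_def)
    then have "Limsup (at_right 0) (\<lambda>\<epsilon>. ereal (U \<epsilon>)) = ereal (- I r (with_density \<rho>))"
      by (intro lim_imp_Limsup) auto
    moreover have "F \<le> Limsup (at_right 0) (\<lambda>\<epsilon>. ereal (U \<epsilon>))"
      unfolding F_def
    proof (rule Limsup_mono)
      have "\<forall>\<^sub>F \<epsilon> in at_right 0. (0::real) < \<epsilon>" by (rule eventually_at_right_less)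
      with EM show "\<forall>\<^sub>F \<epsilon> in at_right 0. discrete_energy \<sigma> \<epsilon> (\<mu> \<epsilon>) \<le> ereal (U \<epsilon>)"
      proof eventually_elim
        case (elim \<epsilon>)
        then obtain N x where x: "\<mu> \<epsilon> = dirac_sum N x" "separated \<epsilon> N x" unfolding EM_def by blast
        have "point_energy \<sigma> \<epsilon> N x \<le> U \<epsilon>"
          unfolding U_def I_def rescaled_def x(1)
          by (rule point_energy_le[OF elim(2) x(2) s s_def r])
        then show ?case by (simp add: x discrete_energy_dirac_sum[OF elim(2)])
      qed
    qed
    ultimately show ?thesis by simp
  qed
  have pos: "0 \<le> I r M" for r M
    unfolding I_def by (intro Bochner_Integration.integral_nonneg truncated_kernel_nonneg)
  show ?thesis
    unfolding F_def[symmetric]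
  proof (cases F)
    case (real l)
    have "I r (with_density \<rho>) \<le> - l" if "0 < r" for r using le[OF that] real by simp
    then have "(\<integral>\<^sup>+ (x, y). ennreal (riesz_kernel s (x - y)) \<partial>(with_density \<rho> \<Otimes>\<^sub>M with_density \<rho>)) \<le> ennreal (- l)"
      unfolding I_def by (rule riesz_energy_le_truncated_bound[OF with_density_Mb[OF \<rho>] s])
    then have "enn2ereal (\<integral>\<^sup>+ (x, y). ennreal (riesz_kernel s (x - y)) \<partial>(with_density \<rho> \<Otimes>\<^sub>M with_density \<rho>))
        \<le> enn2ereal (ennreal (- l))"
      by (simp only: less_eq_ennreal.rep_eq)
    moreover have "0 \<le> - l" using le[of 1] pos[of 1 "with_density \<rho>"] real by simp
    ultimately have "enn2ereal (\<integral>\<^sup>+ (x, y). ennreal (riesz_kernel s (x - y)) \<partial>(with_density \<rho> \<Otimes>\<^sub>M with_density \<rho>)) \<le> - F"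
      by (simp add: enn2ereal_ennreal real)
    then show "F \<le> limit_energy \<sigma> (with_density \<rho>)"
      unfolding limit_energy_eq[OF with_density_le_lborel[OF \<rho>] s_def] by (metis ereal_minus_le_minus ereal_uminus_uminus)
  next
    case PInf
    then show "F \<le> limit_energy \<sigma> (with_density \<rho>)" using le[of 1] by simp
  next
    case MInf
    then show "F \<le> limit_energy \<sigma> (with_density \<rho>)" by simp
  qed
qed

section \<open>Approximation by thinned packings\<close>

text \<open>
  On a cell \<open>Q\<close> where \<open>f\<close> oscillates by at most \<open>w\<close>, both sides may be replaced by multiples of the
  value \<open>f z\<close>, at the cost of \<open>w\<close> times their masses; what is left is the difference of the masses.
\<close>

lemma integral_cell_error:
  fixes f :: "'a::euclidean_space \<Rightarrow> real"
  assumes "M \<in> Mb" "f \<in> borel_measurable borel" "\<And>x. \<bar>f x\<bar> \<le> B" "Q \<in> sets borel"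
    and Y: "finite Y" "Y \<subseteq> Q" "0 \<le> c" "c * real (card Y) \<le> measure M Q"
    and w: "z \<in> Q" "\<And>x. x \<in> Q \<Longrightarrow> \<bar>f x - f z\<bar> \<le> w"
  shows "\<bar>c * (\<Sum>y\<in>Y. f y) - (\<integral>x. f x * indicator Q x \<partial>M)\<bar>
    \<le> 2 * w * measure M Q + B * (measure M Q - c * real (card Y))"
proof -
  let ?q = "measure M Q"
  note [measurable] = assms(2,4)
  have B: "0 \<le> B" using assms(3)[of 0] by linarith
  have w0: "0 \<le> w" using w(2)[OF w(1)] by simp
  have "\<bar>\<Sum>y\<in>Y. f y - f z\<bar> \<le> (\<Sum>y\<in>Y. w)"
    using Y(2) w(2) by (intro order_trans[OF sum_abs sum_mono]) auto
  then have "c * \<bar>\<Sum>y\<in>Y. f y - f z\<bar> \<le> c * (real (card Y) * w)"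
    using Y(3) by (intro mult_left_mono) auto
  also have "\<dots> = w * (c * real (card Y))" by simp
  also have "\<dots> \<le> w * ?q" using Y(4) w0 by (rule mult_left_mono)
  finally have 1: "\<bar>c * ((\<Sum>y\<in>Y. f y) - real (card Y) * f z)\<bar> \<le> w * ?q"
    using Y(3) by (simp add: abs_mult sum_subtractf)
  have int: "integrable M (\<lambda>x. f x * indicator Q x)" "integrable M (\<lambda>x. indicator Q x :: real)"
    using assms(1,3) B
    by (intro Mb_integrable[where B=B], auto simp: indicator_def)
      (intro Mb_integrable[where B=1], auto simp: indicator_def)
  have ind: "(\<integral>x. indicator Q x \<partial>M) = ?q" using MbD(3)[OF assms(1)] by simp
  have "(\<integral>x. f x * indicator Q x \<partial>M) - f z * ?q = (\<integral>x. f x * indicator Q x - f z * indicator Q x \<partial>M)"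
    using int ind by simp
  also have "\<bar>\<dots>\<bar> \<le> (\<integral>x. \<bar>f x * indicator Q x - f z * indicator Q x\<bar> \<partial>M)" by (rule integral_abs_bound)
  also have "\<dots> \<le> (\<integral>x. w * indicator Q x \<partial>M)"
    using int w(2) by (intro integral_mono integrable_abs Bochner_Integration.integrable_diff integrable_mult_right) (auto simp: indicator_def)
  also have "\<dots> = w * ?q" using ind by simp
  finally have 2: "\<bar>(\<integral>x. f x * indicator Q x \<partial>M) - f z * ?q\<bar> \<le> w * ?q" .
  have "\<bar>f z * (?q - c * real (card Y))\<bar> \<le> B * (?q - c * real (card Y))"
    unfolding abs_mult using Y(4) by (intro mult_mono assms(3) B) auto
  moreover have "c * (\<Sum>y\<in>Y. f y) - (\<integral>x. f x * indicator Q x \<partial>M) =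
      c * ((\<Sum>y\<in>Y. f y) - real (card Y) * f z) - ((\<integral>x. f x * indicator Q x \<partial>M) - f z * ?q) - f z * (?q - c * real (card Y))"
    by (simp add: algebra_simps)
  ultimately show ?thesis using 1 2 by linarith
qed

text \<open>
  The first inequality says that a single atom is negligible against the cell, so that rounding to
  an integer number of points is harmless. The second one says that the full packing
  fills the cell up to the fraction \<open>\<kappa>\<close>. Both are stated for the cell of side \<open>r + 2\<close> since the margin 2
  separates the packings of neighbouring cells; its relative volume tends to 0 as \<open>r\<close> grows.
\<close>

lemma efficient_packing:
  assumes "0 < (\<kappa>::real)"
  obtains r and P :: "'a::euclidean_space set" where "0 < r" "P \<subseteq> half_open_cube 0 r" "finite P"
    "pairwise (\<lambda>x y. 2 \<le> dist x y) P"
    "omega TYPE('a) / packing_density TYPE('a) \<le> \<kappa> * (r + 2) ^ DIM('a)"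
    "(r + 2) ^ DIM('a) - omega TYPE('a) / packing_density TYPE('a) * card P \<le> \<kappa> * (r + 2) ^ DIM('a)"
proof -
  define C where "C = packing_density TYPE('a)"
  have C: "0 < C" unfolding C_def by (rule packing_density_pos)
  have w: "0 < omega TYPE('a)" by (rule omega_pos)
  \<comment> \<open>one factor \<open>1 - \<tau>\<close> is lost to the packing and one to the margin of the cell\<close>
  define \<tau> where "\<tau> = min (\<kappa> / 2) 1"
  have t: "0 < \<tau>" "\<tau> \<le> 1" "2 * \<tau> \<le> \<kappa>" using assms by (auto simp: \<tau>_def)
  have inf: "filterlim (\<lambda>r::real. r + 2) at_infinity at_top"
    using filterlim_at_top_imp_at_infinity[OF filterlim_tendsto_add_at_top[OF tendsto_const[of 2] filterlim_ident]]
    by (simp add: add.commute)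
  have "((\<lambda>r::real. (1 - 2 / (r + 2)) ^ DIM('a)) \<longlongrightarrow> (1 - 0) ^ DIM('a)) at_top"
    by (intro tendsto_power tendsto_diff tendsto_const tendsto_divide_0[OF tendsto_const inf])
  then have "\<forall>\<^sub>F r::real in at_top. 1 - \<tau> < (1 - 2 / (r + 2)) ^ DIM('a)"
    by (rule order_tendstoD(1)) (use t in simp)
  moreover have "\<forall>\<^sub>F r::real in at_top. omega TYPE('a) / C / \<kappa> + 1 \<le> r" by (rule eventually_ge_at_top)
  ultimately obtain R where R: "\<And>r. R \<le> r \<Longrightarrow> 1 - \<tau> < (1 - 2 / (r + 2)) ^ DIM('a) \<and> omega TYPE('a) / C / \<kappa> + 1 \<le> r"
    using eventually_at_top_linorder[of "\<lambda>r. 1 - \<tau> < (1 - 2 / (r + 2)) ^ DIM('a) \<and> omega TYPE('a) / C / \<kappa> + 1 \<le> r"]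
    by (auto simp: eventually_conj_iff)
  have "(1 - \<tau>) * C < packing_density TYPE('a)" using C t by (simp add: C_def)
  then obtain r and P :: "'a set" where P: "R \<le> r" "0 < r" "P \<subseteq> half_open_cube 0 r" "finite P"
    "pairwise (\<lambda>x y. 2 \<le> dist x y) P" "(1 - \<tau>) * C < real (card P) * omega TYPE('a) / r ^ DIM('a)"
    by (rule near_optimal_packing)
  define V where "V = (r + 2) ^ DIM('a)"
  have V: "0 < V" using P(2) by (simp add: V_def)
  have r: "1 - \<tau> < (r / (r + 2)) ^ DIM('a)" "omega TYPE('a) / C / \<kappa> + 1 \<le> r"
  proof -
    have "1 - 2 / (r + 2) = r / (r + 2)" using P(2) by (simp add: field_simps)
    then show "1 - \<tau> < (r / (r + 2)) ^ DIM('a)" "omega TYPE('a) / C / \<kappa> + 1 \<le> r" using R[OF P(1)] by auto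
  qed
  have "omega TYPE('a) / C / \<kappa> + 1 \<le> (r + 2) ^ 1" using r(2) by simp
  also have "\<dots> \<le> V" unfolding V_def using P(2) by (intro power_increasing) (auto simp: Suc_le_eq)
  finally have "omega TYPE('a) / C / \<kappa> \<le> V" by simp
  then have one: "omega TYPE('a) / C \<le> \<kappa> * V" using pos_divide_le_eq[OF assms] by (metis mult.commute)
  have rd: "(1 - \<tau>) * V \<le> r ^ DIM('a)"
    using r(1) V P(2) by (simp add: V_def power_divide pos_less_divide_eq)
  have "(1 - \<tau>) * (1 - \<tau>) = 1 - 2 * \<tau> + \<tau> * \<tau>" by (simp add: algebra_simps)
  then have "1 - \<kappa> \<le> (1 - \<tau>) * (1 - \<tau>)"
    using t(3) zero_le_square[of \<tau>] by linarith
  then have "(1 - \<kappa>) * V \<le> ((1 - \<tau>) * (1 - \<tau>)) * V"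
    using V by (intro mult_right_mono) auto
  also have "\<dots> = (1 - \<tau>) * ((1 - \<tau>) * V)" by simp
  also have "\<dots> \<le> (1 - \<tau>) * r ^ DIM('a)" using rd t by (intro mult_left_mono) auto
  also have "\<dots> \<le> omega TYPE('a) / C * card P"
    using P(2,6) C by (simp add: field_simps)
  finally have "V - omega TYPE('a) / C * card P \<le> \<kappa> * V" by (simp add: algebra_simps)
  with one show ?thesis using that[of r P] P unfolding V_def C_def by blast
qed

lemma cells_disjoint:
  fixes z z' :: "'a::euclidean_space"
  assumes "0 < l" "z \<in> cubic_lattice l" "z' \<in> cubic_lattice l" "z \<noteq> z'"
  shows "half_open_cube z l \<inter> half_open_cube z' l = {}"
proof (rule ccontr)
  assume "\<not> ?thesis"
  then obtain x where "x \<in> half_open_cube z l" "x \<in> half_open_cube z' l" by blast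
  from half_open_cubes_separated[OF assms this] show False by simp
qed

lemma EM_of_set:
  fixes S :: "'a::euclidean_space set"
  assumes "finite S" "pairwise (\<lambda>x y. 2 * \<epsilon> \<le> dist x y) S"
  obtains M where "M \<in> EM \<epsilon>"
    "\<And>c f. 0 \<le> c \<Longrightarrow> f \<in> borel_measurable borel \<Longrightarrow> (\<integral>y. f y \<partial>scale_measure (ennreal c) M) = c * (\<Sum>y\<in>S. f y :: real)"
proof -
  obtain x where x: "bij_betw x {..<card S} S"
    using ex_bij_betw_nat_finite[OF assms(1)] by (auto simp: lessThan_atLeast0)
  have "separated \<epsilon> (card S) x"
    unfolding separated_def
  proof (intro allI impI)
    fix i j assume ij: "i < card S" "j < card S" "i \<noteq> j"
    then have "x i \<in> S" "x j \<in> S" "x i \<noteq> x j"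
      using x by (auto simp: bij_betw_def inj_on_def)
    then show "2 * \<epsilon> \<le> dist (x i) (x j)" using assms(2) by (auto simp: pairwise_def)
  qed
  then have "dirac_sum (card S) x \<in> EM \<epsilon>" by (auto simp: EM_def)
  moreover have "(\<integral>y. f y \<partial>scale_measure (ennreal c) (dirac_sum (card S) x)) = c * (\<Sum>y\<in>S. f y)"
    if "0 \<le> c" "f \<in> borel_measurable borel" for c and f :: "'a \<Rightarrow> real"
    using integral_scaled_dirac_sum[OF that] sum.reindex_bij_betw[OF x, of f] by simp
  ultimately show ?thesis using that by blast
qed

text \<open>
  In each cell one keeps as many points of the scaled packing as fit under the mass \<open>q\<close> that \<open>M\<close>
  gives to the cell. The deficit is less than one atom if the packing has enough points for this. If the
  packing is exhausted, the deficit is the unfilled part of the cell, because \<open>M \<le> lborel\<close> bounds \<open>q\<close> by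
  the volume. So each deficit is at most \<open>\<kappa>\<close> times the volume of the cell. Only the cells meeting a
  large ball are used; the rest of the space carries little mass. The error is stated uniformly in
  the test function to make a diagonal choice possible.
\<close>

lemma packing_approximation:
  fixes M :: "'a::euclidean_space measure"
  assumes M: "M \<in> Mb" "M \<le> lborel" and \<eta>: "0 < \<eta>"
  shows "\<forall>\<^sub>F \<epsilon> in at_right 0. \<exists>M'\<in>EM \<epsilon>. \<forall>f B w. f \<in> borel_measurable borel \<longrightarrow> (\<forall>x. \<bar>f x\<bar> \<le> B) \<longrightarrow>
    (\<forall>x y. dist x y \<le> \<eta> \<longrightarrow> \<bar>f x - f y\<bar> \<le> w) \<longrightarrow>
    \<bar>(\<integral>x. f x \<partial>scale_measure (ennreal (atom_mass TYPE('a) \<epsilon>)) M') - (\<integral>x. f x \<partial>M)\<bar> \<le> 2 * w * measure M UNIV + B * \<eta>"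
proof -
  interpret finite_measure M by (rule MbD(1)[OF M(1)])
  have setsM: "sets M = sets borel" and spaceM: "space M = UNIV" using MbD[OF M(1)] by auto
  have le_leb: "measure M (half_open_cube z l) \<le> l ^ DIM('a)" if "0 < l" for z l
  proof -
    have "emeasure M \<le> emeasure lborel" using M(2) setsM spaceM by (simp add: le_measure_iff)
    then have "emeasure M (half_open_cube z l) \<le> emeasure lborel (half_open_cube z l)" by (rule le_funD)
    then show ?thesis
      using that by (simp add: emeasure_half_open_cube emeasure_eq_measure)
  qed
  have "(\<lambda>n. measure M (cball 0 (real n))) \<longlonglongrightarrow> measure M (\<Union>n. cball 0 (real n))"
  proof (rule finite_Lim_measure_incseq)
    show "range (\<lambda>n. cball (0::'a) (real n)) \<subseteq> sets M"
      unfolding setsM by (intro image_subsetI borel_closed closed_cball)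
    show "incseq (\<lambda>n. cball (0::'a) (real n))"
      by (intro monoI subset_cball) simp
  qed
  also have "(\<Union>n. cball 0 (real n)) = (UNIV :: 'a set)"
    by (simp add: set_eq_iff real_arch_simple)
  finally have "\<forall>\<^sub>F n in sequentially. measure M UNIV - \<eta> / 2 < measure M (cball 0 (real n))"
    by (rule order_tendstoD(1)) (use \<eta> in simp)
  then obtain T where T: "measure M UNIV - \<eta> / 2 < measure M (cball 0 (real T))"
    using eventually_happens' by force
  \<comment> \<open>the cells that meet the ball of radius \<open>T\<close> have diameter at most \<open>d\<close> and so lie in this larger ball\<close>
  define V where "V = measure lborel (cball (0::'a) (real T + 2 * real DIM('a)))"
  have V: "0 \<le> V" by (simp add: V_def)
  \<comment> \<open>the deficits add up to at most \<open>\<kappa> V\<close>\<close>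
  define \<kappa> where "\<kappa> = \<eta> / (2 * (V + 1))"
  have \<kappa>: "0 < \<kappa>" "\<kappa> * V \<le> \<eta> / 2"
  proof -
    show "0 < \<kappa>" using \<eta> V by (simp add: \<kappa>_def)
    have "\<kappa> * V = \<eta> / 2 * (V / (V + 1))" by (simp add: \<kappa>_def)
    also have "\<dots> \<le> \<eta> / 2 * 1" using \<eta> V by (intro mult_left_mono) auto
    finally show "\<kappa> * V \<le> \<eta> / 2" by simp
  qed
  define \<omega>C where "\<omega>C = omega TYPE('a) / packing_density TYPE('a)"
  obtain r and P :: "'a set" where P: "0 < r" "P \<subseteq> half_open_cube 0 r" "finite P"
    "pairwise (\<lambda>x y. 2 \<le> dist x y) P" "\<omega>C \<le> \<kappa> * (r + 2) ^ DIM('a)"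
    "(r + 2) ^ DIM('a) - \<omega>C * card P \<le> \<kappa> * (r + 2) ^ DIM('a)"
    unfolding \<omega>C_def by (rule efficient_packing[OF \<kappa>(1)])
  obtain sel where sel: "\<And>k. k \<le> card P \<Longrightarrow> sel k \<subseteq> P \<and> card (sel k) = k"
    using obtain_subset_with_card_n by metis
  have "\<forall>\<^sub>F \<epsilon> in at_right 0. \<epsilon> < min (1 / (r + 2)) (\<eta> / (real DIM('a) * (r + 2)))"
    using \<eta> P(1) by (intro order_tendstoD(2)[OF tendsto_ident_at]) (simp add: add_pos_pos)
  moreover have "\<forall>\<^sub>F \<epsilon> in at_right 0. (0::real) < \<epsilon>" by (rule eventually_at_right_less)
  ultimately show ?thesis
  proof eventually_elim
    case (elim \<epsilon>)
    then have \<epsilon>: "0 < \<epsilon>" by simp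
    \<comment> \<open>side of a cell; the points occupy only the part of side \<open>\<epsilon> * r\<close>\<close>
    define l where "l = \<epsilon> * (r + 2)"
    define c where "c = atom_mass TYPE('a) \<epsilon>"
    have l: "0 < l" "l \<le> 1" "real DIM('a) * l \<le> \<eta>"
    proof -
      show "0 < l" using \<epsilon> P(1) by (simp add: l_def)
      show "l \<le> 1" using elim P(1) by (simp add: l_def pos_less_divide_eq)
      have "\<epsilon> * (real DIM('a) * (r + 2)) < \<eta>"
        using elim P(1) by (subst (asm) min_less_iff_conj, subst (asm) pos_less_divide_eq[of "real DIM('a) * (r + 2)"]) auto
      then show "real DIM('a) * l \<le> \<eta>" by (simp add: l_def mult.left_commute)
    qed
    have c: "0 < c" unfolding c_def by (rule atom_mass_pos[OF \<epsilon>])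
    have c_eq: "c = \<epsilon> ^ DIM('a) * \<omega>C" by (simp add: c_def \<omega>C_def)
    have c_le: "c \<le> \<kappa> * l ^ DIM('a)" "l ^ DIM('a) - c * card P \<le> \<kappa> * l ^ DIM('a)"
    proof -
      have e: "0 \<le> \<epsilon> ^ DIM('a)" using \<epsilon> by simp
      show "c \<le> \<kappa> * l ^ DIM('a)"
        using mult_left_mono[OF P(5) e] by (simp add: c_eq l_def power_mult_distrib mult.left_commute)
      show "l ^ DIM('a) - c * card P \<le> \<kappa> * l ^ DIM('a)"
        using mult_left_mono[OF P(6) e] by (simp add: c_eq l_def power_mult_distrib mult.left_commute right_diff_distrib mult.assoc)
    qed
    define Q where "Q z = half_open_cube z l" for z :: 'a
    have Qb: "Q z \<in> sets borel" for z by (simp add: Q_def)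
    have Qdist: "dist x y \<le> real DIM('a) * l" if "x \<in> Q z" "y \<in> Q z" for x y z
      using dist_half_open_cube that unfolding Q_def by blast
    have Qz: "z \<in> Q z" for z using half_open_cube_corner[OF l(1)] by (simp add: Q_def)
    define Z where "Z = {z \<in> cubic_lattice l. Q z \<inter> cball 0 (real T) \<noteq> {}}"
    have sub: "Q z \<subseteq> cball 0 (real T + 2 * real DIM('a))" if z: "z \<in> Z" for z
    proof
      fix x assume x: "x \<in> Q z"
      obtain y where y: "y \<in> Q z" "norm y \<le> real T" using z unfolding Z_def by fastforce
      have "real DIM('a) * l \<le> real DIM('a) * 1" using l(2) by (intro mult_left_mono) auto
      then have "dist x y \<le> real DIM('a)" using Qdist[OF x y(1)] by linarith
      then show "x \<in> cball 0 (real T + 2 * real DIM('a))"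
        using y(2) norm_triangle_ineq2[of x y] by (simp add: dist_norm)
    qed
    have finZ: "finite Z"
    proof (rule finite_subset)
      show "Z \<subseteq> cubic_lattice l \<inter> cball 0 (real T + 2 * real DIM('a))"
        using sub Qz by (auto simp: Z_def)
      show "finite (cubic_lattice l \<inter> cball (0::'a) (real T + 2 * real DIM('a)))"
        by (rule finite_cubic_lattice[OF l(1) bounded_cball])
    qed
    have disjQ: "disjoint_family_on Q Z"
      unfolding disjoint_family_on_def Q_def using cells_disjoint[OF l(1)] by (auto simp: Z_def)
    define U where "U = (\<Union>z\<in>Z. Q z)"
    have Ub: "U \<in> sets borel" unfolding U_def using finZ Qb by blast
    have cover: "cball 0 (real T) \<subseteq> U"
    proof
      fix x :: 'a assume x: "x \<in> cball 0 (real T)"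
      obtain z where "z \<in> cubic_lattice l" "x \<in> half_open_cube z l" by (rule cubic_lattice_cover[OF l(1), of x])
      then show "x \<in> U" using x unfolding U_def Z_def Q_def by blast
    qed
    define q where "q z = measure M (Q z)" for z
    have sumq: "(\<Sum>z\<in>Z. q z) = measure M U"
      unfolding q_def U_def using finZ disjQ Qb setsM by (intro finite_measure_finite_Union[symmetric]) auto
    have far: "measure M UNIV - (\<Sum>z\<in>Z. q z) \<le> \<eta> / 2"
    proof -
      have "measure M (cball 0 (real T)) \<le> measure M U"
        using cover Ub setsM by (intro finite_measure_mono) auto
      then show ?thesis using T sumq by linarith
    qed
    have vol: "real (card Z) * l ^ DIM('a) \<le> V"
    proof -
      have "(\<Sum>z\<in>Z. emeasure lborel (Q z)) = emeasure lborel U"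
        unfolding U_def using finZ disjQ Qb by (intro sum_emeasure) auto
      also have "\<dots> \<le> emeasure lborel (cball (0::'a) (real T + 2 * real DIM('a)))"
        using sub by (intro emeasure_mono) (auto simp: U_def)
      also have "\<dots> = ennreal V"
        unfolding V_def by (rule emeasure_eq_ennreal_measure) (metis emeasure_lborel_cball_finite infinity_ennreal_def less_irrefl)
      also have "(\<Sum>z\<in>Z. emeasure lborel (Q z)) = ennreal (real (card Z) * l ^ DIM('a))"
        using l(1) by (simp add: Q_def emeasure_half_open_cube ennreal_mult' ennreal_of_nat_eq_real_of_nat)
      finally show ?thesis using V by simp
    qed
    \<comment> \<open>the number of points to be kept in the cell at \<open>z\<close>\<close>
    define k where "k z = min (card P) (nat \<lfloor>q z / c\<rfloor>)" for z
    have q0: "0 \<le> q z" for z by (simp add: q_def)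
    have k_le: "c * real (k z) \<le> q z" for z
    proof -
      have "real (k z) \<le> real (nat \<lfloor>q z / c\<rfloor>)" by (simp add: k_def)
      also have "\<dots> \<le> q z / c" using q0[of z] c by simp
      finally show ?thesis using c by (simp add: field_simps)
    qed
    have deficit: "q z - c * real (k z) \<le> \<kappa> * l ^ DIM('a)" for z
    proof (cases "card P \<le> nat \<lfloor>q z / c\<rfloor>")
      case True
      then show ?thesis using c_le(2) le_leb[OF l(1), of z] by (simp add: k_def q_def Q_def min_def)
    next
      case False
      then have "k z = nat \<lfloor>q z / c\<rfloor>" by (simp add: k_def)
      then have "q z / c < real (k z) + 1" using q0[of z] c by (simp add: of_nat_nat)
      then show ?thesis using c c_le(1) by (simp add: field_simps)
    qed
    define Y where "Y z = (\<lambda>p. z + \<epsilon> *\<^sub>R p) ` sel (k z)" for z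
    have selk: "sel (k z) \<subseteq> P" "card (sel (k z)) = k z" for z
      using sel[of "k z"] by (auto simp: k_def)
    have Yfin: "finite (Y z)" for z
      unfolding Y_def using finite_subset[OF selk(1) P(3)] by (rule finite_imageI)
    have Ycard: "card (Y z) = k z" for z
      unfolding Y_def using \<epsilon> selk(2) by (subst card_image) (auto simp: inj_on_def)
    have Ysub: "Y z \<subseteq> half_open_cube z (\<epsilon> * r)" for z
    proof
      fix y assume "y \<in> Y z"
      then obtain p where p: "p \<in> P" "y = z + \<epsilon> *\<^sub>R p" using selk(1)[of z] by (auto simp: Y_def)
      then show "y \<in> half_open_cube z (\<epsilon> * r)"
        using P(2) \<epsilon> by (auto simp: half_open_cube_def inner_add_left)
    qed
    have YQ: "Y z \<subseteq> Q z" for z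
    proof -
      have "half_open_cube z (\<epsilon> * r) \<subseteq> Q z"
        using \<epsilon> by (auto simp: half_open_cube_def Q_def l_def algebra_simps intro: less_trans)
      with Ysub show ?thesis by blast
    qed
    define S where "S = (\<Union>z\<in>Z. Y z)"
    have Sfin: "finite S" unfolding S_def using finZ Yfin by blast
    have Ssep: "pairwise (\<lambda>x y. 2 * \<epsilon> \<le> dist x y) S"
      unfolding pairwise_def
    proof (intro ballI impI)
      fix x y assume xy: "x \<in> S" "y \<in> S" "x \<noteq> y"
      then obtain z z' where z: "z \<in> Z" "x \<in> Y z" "z' \<in> Z" "y \<in> Y z'" by (auto simp: S_def)
      show "2 * \<epsilon> \<le> dist x y"
      proof (cases "z = z'")
        case True
        then obtain p p' where p: "p \<in> P" "p' \<in> P" "x = z + \<epsilon> *\<^sub>R p" "y = z + \<epsilon> *\<^sub>R p'"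
          using z selk(1)[of z] by (auto simp: Y_def)
        then have "p \<noteq> p'" using xy(3) by auto
        then have "2 \<le> dist p p'" using P(4) p by (auto simp: pairwise_def)
        moreover have "dist x y = \<epsilon> * dist p p'"
          using \<epsilon> by (simp add: p dist_norm flip: scaleR_diff_right)
        ultimately show ?thesis using \<epsilon> by simp
      next
        case False
        have "l - \<epsilon> * r < dist x y"
          using z Ysub unfolding Z_def by (intro half_open_cubes_separated[OF l(1) _ _ False]) blast+
        then show ?thesis by (simp add: l_def algebra_simps)
      qed
    qed
    obtain M' where M': "M' \<in> EM \<epsilon>"
      "\<And>c f. 0 \<le> c \<Longrightarrow> f \<in> borel_measurable borel \<Longrightarrow> (\<integral>y. f y \<partial>scale_measure (ennreal c) M') = c * (\<Sum>y\<in>S. f y :: real)"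
      by (rule EM_of_set[OF Sfin Ssep]) blast
    have "\<bar>(\<integral>x. f x \<partial>scale_measure (ennreal c) M') - (\<integral>x. f x \<partial>M)\<bar> \<le> 2 * w * measure M UNIV + B * \<eta>"
      if f: "f \<in> borel_measurable borel" "\<forall>x. \<bar>f x\<bar> \<le> B" "\<forall>x y. dist x y \<le> \<eta> \<longrightarrow> \<bar>f x - f y\<bar> \<le> w" for f B w
    proof -
      note [measurable] = f(1) Qb Ub
      have B: "0 \<le> B" using f(2)[rule_format, of 0] by linarith
      have w: "0 \<le> w" using f(3)[rule_format, of 0 0] \<eta> by simp
      have int: "integrable M (\<lambda>x. f x * indicator A x)" if "A \<in> sets borel" for A
        using M(1) f(1,2) that B by (intro Mb_integrable[where B=B]) (auto simp: indicator_def)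
      have "c * (\<Sum>y\<in>S. f y) = (\<Sum>z\<in>Z. c * (\<Sum>y\<in>Y z. f y))"
      proof -
        have "(\<Sum>y\<in>S. f y) = (\<Sum>z\<in>Z. \<Sum>y\<in>Y z. f y)"
          unfolding S_def
        proof (rule sum.UNION_disjoint[OF finZ])
          show "\<forall>i\<in>Z. finite (Y i)" using Yfin by blast
          show "\<forall>i\<in>Z. \<forall>j\<in>Z. i \<noteq> j \<longrightarrow> Y i \<inter> Y j = {}"
            using disjQ YQ unfolding disjoint_family_on_def by blast
        qed
        then show ?thesis by (simp add: sum_distrib_left)
      qed
      moreover have "(\<integral>x. f x \<partial>M) = (\<Sum>z\<in>Z. \<integral>x. f x * indicator (Q z) x \<partial>M) + (\<integral>x. f x * indicator (- U) x \<partial>M)"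
      proof -
        have "f x = (\<Sum>z\<in>Z. f x * indicator (Q z) x) + f x * indicator (- U) x" for x
        proof -
          have "indicator U x = (\<Sum>z\<in>Z. indicator (Q z) x :: real)"
            unfolding U_def using finZ disjQ by (intro indicator_UN_disjoint)
          then have "(\<Sum>z\<in>Z. f x * indicator (Q z) x) = f x * indicator U x" by (simp add: sum_distrib_left)
          then show ?thesis by (auto simp: indicator_def)
        qed
        then have "(\<integral>x. f x \<partial>M) = (\<integral>x. (\<Sum>z\<in>Z. f x * indicator (Q z) x) + f x * indicator (- U) x \<partial>M)"
          by simp
        also have "\<dots> = (\<integral>x. (\<Sum>z\<in>Z. f x * indicator (Q z) x) \<partial>M) + (\<integral>x. f x * indicator (- U) x \<partial>M)"
          using Qb Ub by (intro Bochner_Integration.integral_add Bochner_Integration.integrable_sum int) auto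
        also have "(\<integral>x. (\<Sum>z\<in>Z. f x * indicator (Q z) x) \<partial>M) = (\<Sum>z\<in>Z. \<integral>x. f x * indicator (Q z) x \<partial>M)"
          using Qb by (intro Bochner_Integration.integral_sum int)
        finally show ?thesis .
      qed
      moreover have "\<bar>(\<Sum>z\<in>Z. c * (\<Sum>y\<in>Y z. f y)) - (\<Sum>z\<in>Z. \<integral>x. f x * indicator (Q z) x \<partial>M)\<bar>
          \<le> 2 * w * (\<Sum>z\<in>Z. q z) + B * (\<eta> / 2)"
      proof -
        have "\<bar>(\<Sum>z\<in>Z. c * (\<Sum>y\<in>Y z. f y)) - (\<Sum>z\<in>Z. \<integral>x. f x * indicator (Q z) x \<partial>M)\<bar>
            \<le> (\<Sum>z\<in>Z. \<bar>c * (\<Sum>y\<in>Y z. f y) - (\<integral>x. f x * indicator (Q z) x \<partial>M)\<bar>)"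
          unfolding sum_subtractf[symmetric] by (rule sum_abs)
        also have "\<dots> \<le> (\<Sum>z\<in>Z. 2 * w * q z + B * (\<kappa> * l ^ DIM('a)))"
        proof (rule sum_mono)
          fix z assume "z \<in> Z"
          have "\<bar>c * (\<Sum>y\<in>Y z. f y) - (\<integral>x. f x * indicator (Q z) x \<partial>M)\<bar>
              \<le> 2 * w * measure M (Q z) + B * (measure M (Q z) - c * real (card (Y z)))"
          proof (rule integral_cell_error[OF M(1) f(1) f(2)[rule_format] Qb Yfin YQ less_imp_le[OF c] _ Qz[of z]])
            show "c * real (card (Y z)) \<le> measure M (Q z)" using k_le[of z] by (simp add: Ycard q_def)
            show "\<bar>f x - f z\<bar> \<le> w" if "x \<in> Q z" for x
              using f(3)[rule_format, of x z] Qdist[OF that Qz] l(3) by linarith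
          qed
          also have "B * (measure M (Q z) - c * real (card (Y z))) \<le> B * (\<kappa> * l ^ DIM('a))"
            using deficit[of z] B unfolding Ycard q_def by (rule mult_left_mono)
          finally show "\<bar>c * (\<Sum>y\<in>Y z. f y) - (\<integral>x. f x * indicator (Q z) x \<partial>M)\<bar> \<le> 2 * w * q z + B * (\<kappa> * l ^ DIM('a))"
            by (simp add: q_def)
        qed
        also have "\<dots> = 2 * w * (\<Sum>z\<in>Z. q z) + B * (\<kappa> * (real (card Z) * l ^ DIM('a)))"
          by (simp add: sum.distrib sum_distrib_left)
        also have "B * (\<kappa> * (real (card Z) * l ^ DIM('a))) \<le> B * (\<eta> / 2)"
          using vol \<kappa> by (intro mult_left_mono B) (meson less_imp_le mult_left_mono order_trans)
        finally show ?thesis by simp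
      qed
      moreover have "\<bar>\<integral>x. f x * indicator (- U) x \<partial>M\<bar> \<le> B * (\<eta> / 2)"
      proof -
        have "\<bar>\<integral>x. f x * indicator (- U) x \<partial>M\<bar> \<le> (\<integral>x. \<bar>f x * indicator (- U) x\<bar> \<partial>M)" by (rule integral_abs_bound)
        also have "\<dots> \<le> (\<integral>x. B * indicator (- U) x \<partial>M)"
        proof (intro integral_mono integrable_abs integrable_mult_right int)
          show "- U \<in> sets borel" using Ub by (rule borel_comp)
          then show "integrable M (indicator (- U) :: 'a \<Rightarrow> real)"
            by (intro Mb_integrable[OF M(1), where B=1]) (auto simp: indicator_def)
          show "\<bar>f x * indicator (- U) x\<bar> \<le> B * indicator (- U) x" for x
            using f(2) by (simp add: indicator_def)
        qed
        also have "\<dots> = B * measure M (- U)" using spaceM by simp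
        also have "measure M (- U) = measure M UNIV - (\<Sum>z\<in>Z. q z)"
          using finite_measure_compl[of U] Ub setsM spaceM sumq by (simp add: Compl_eq_Diff_UNIV)
        also have "B * \<dots> \<le> B * (\<eta> / 2)" using far B by (rule mult_left_mono)
        finally show ?thesis .
      qed
      moreover have "2 * w * (\<Sum>z\<in>Z. q z) \<le> 2 * w * measure M UNIV"
        using w sumq finite_measure_mono[of U UNIV] setsM by (intro mult_left_mono) auto
      moreover have "B * (\<eta> / 2) + B * (\<eta> / 2) = B * \<eta>" by simp
      ultimately show ?thesis
        unfolding M'(2)[OF less_imp_le[OF c] f(1)] by linarith
    qed
    then show ?case using M'(1) unfolding c_def by blast
  qed
qed

section \<open>Recovery families and the theorem\<close>

text \<open>
  For given \<open>\<epsilon>\<close> take the best quality \<open>n \<le> 1/\<epsilon>\<close> that is attainable; the bound \<open>1/\<epsilon>\<close> ensures that a best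
  one exists, and it eventually exceeds every given \<open>n\<close>.
\<close>

lemma diagonal_choice:
  fixes P :: "nat \<Rightarrow> real \<Rightarrow> 'b \<Rightarrow> bool"
  assumes ex: "\<And>n. \<forall>\<^sub>F \<epsilon> in at_right 0. \<exists>S. P n \<epsilon> S"
    and mono: "\<And>n \<epsilon> S. P (Suc n) \<epsilon> S \<Longrightarrow> P n \<epsilon> S"
  obtains S where "\<forall>n. \<forall>\<^sub>F \<epsilon> in at_right 0. P n \<epsilon> (S \<epsilon>)"
proof -
  define G where "G \<epsilon> = {n. real n \<le> 1 / \<epsilon> \<and> (\<exists>S. P n \<epsilon> S)}" for \<epsilon>
  define S where "S \<epsilon> = (SOME S. P (Max (G \<epsilon>)) \<epsilon> S)" for \<epsilon>
  have anti: "P m \<epsilon> S'" if "n \<ge> m" "P n \<epsilon> S'" for m n \<epsilon> S'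
    using that by (induction rule: dec_induct) (auto dest: mono)
  have "\<forall>\<^sub>F \<epsilon> in at_right 0. P n \<epsilon> (S \<epsilon>)" for n
  proof -
    have "\<forall>\<^sub>F \<epsilon> in at_right 0. \<epsilon> < 1 / (real n + 1)"
      by (rule order_tendstoD(2)[OF tendsto_ident_at]) simp
    moreover have "\<forall>\<^sub>F \<epsilon> in at_right 0. (0::real) < \<epsilon>" by (rule eventually_at_right_less)
    ultimately show ?thesis using ex[of n]
    proof eventually_elim
      case (elim \<epsilon>)
      have "G \<epsilon> \<subseteq> {..nat \<lfloor>1 / \<epsilon>\<rfloor>}"
        by (auto simp: G_def le_nat_floor)
      then have fin: "finite (G \<epsilon>)" using finite_subset by blast
      have "\<epsilon> * (real n + 1) < 1" using elim(1) by (simp add: pos_less_divide_eq)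
      then have "real n \<le> 1 / \<epsilon>" using elim(2) by (simp add: pos_le_divide_eq algebra_simps)
      then have n: "n \<in> G \<epsilon>" using elim(3) by (simp add: G_def)
      then have "Max (G \<epsilon>) \<in> G \<epsilon>" using fin Max_in by blast
      then have "P (Max (G \<epsilon>)) \<epsilon> (S \<epsilon>)" unfolding S_def G_def by (blast intro: someI_ex)
      then show ?case using Max_ge[OF fin n] anti by blast
    qed
  qed
  then show ?thesis using that by blast
qed

lemma vanishing_at_infinity_bounded:
  fixes f :: "'a::euclidean_space \<Rightarrow> real"
  assumes "continuous_on UNIV f" "(f \<longlongrightarrow> 0) at_infinity"
  obtains B where "\<And>x. \<bar>f x\<bar> \<le> B"
proof -
  have "\<forall>\<^sub>F x in at_infinity. dist (f x) 0 < 1" using assms(2) by (rule tendstoD) simp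
  then obtain R where R: "\<And>x. R \<le> norm x \<Longrightarrow> \<bar>f x\<bar> < 1" unfolding eventually_at_infinity by auto
  have "compact (f ` cball 0 R)"
    by (intro compact_continuous_image continuous_on_subset[OF assms(1)]) auto
  then obtain b where b: "\<forall>x\<in>cball 0 R. \<bar>f x\<bar> \<le> b"
    using compact_imp_bounded[of "f ` cball 0 R"] unfolding bounded_iff by auto
  have "\<bar>f x\<bar> \<le> max 1 b" for x
    using R[of x] b by (cases "norm x \<le> R") (auto simp: le_max_iff_disj)
  then show ?thesis by (rule that)
qed

text \<open>
  Two points at distance less than 1 either both lie in the ball of radius \<open>R + 1\<close>, where \<open>f\<close> is
  uniformly continuous by compactness, or both lie outside the ball of radius \<open>R\<close>, where \<open>f\<close> is
  small.
\<close>

lemma vanishing_at_infinity_uniformly_continuous: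
  fixes f :: "'a::euclidean_space \<Rightarrow> real"
  assumes "continuous_on UNIV f" "(f \<longlongrightarrow> 0) at_infinity" "0 < e"
  obtains d where "0 < d" "\<And>x y. dist x y < d \<Longrightarrow> \<bar>f x - f y\<bar> < e"
proof -
  have "\<forall>\<^sub>F x in at_infinity. dist (f x) 0 < e / 2" using assms(2) by (rule tendstoD) (use assms(3) in simp)
  then obtain R where R: "\<And>x. R \<le> norm x \<Longrightarrow> \<bar>f x\<bar> < e / 2" unfolding eventually_at_infinity by auto
  have "uniformly_continuous_on (cball 0 (R + 1)) f"
    by (intro compact_uniformly_continuous continuous_on_subset[OF assms(1)]) auto
  then obtain d where d: "0 < d"
    "\<And>x y. x \<in> cball 0 (R + 1) \<Longrightarrow> y \<in> cball 0 (R + 1) \<Longrightarrow> dist x y < d \<Longrightarrow> \<bar>f x - f y\<bar> < e"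
    using assms(3) unfolding uniformly_continuous_on_def dist_real_def by meson
  have "\<bar>f x - f y\<bar> < e" if xy: "dist x y < min d 1" for x y
  proof (cases "norm x \<le> R + 1 \<and> norm y \<le> R + 1")
    case True
    then show ?thesis using d(2)[of x y] xy by simp
  next
    case False
    have "norm x \<le> norm y + dist x y" "norm y \<le> norm x + dist x y"
      using norm_triangle_ineq2[of x y] norm_triangle_ineq2[of y x] by (simp_all add: dist_norm norm_minus_commute)
    then have "R \<le> norm x" "R \<le> norm y" using False xy by auto
    from R[OF this(1)] R[OF this(2)] show ?thesis by linarith
  qed
  then show ?thesis using that[of "min d 1"] d(1) by simp
qed

text \<open>
  Test functions that vanish at infinity and the constant 1, which gives the total
  masses, are uniformly continuous and bounded, so the uniform error bound of
  \<open>packing_approximation\<close> applies to all of them.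
\<close>

lemma recovery_family:
  fixes M :: "'a::euclidean_space measure"
  assumes M: "M \<in> Mb" "M \<le> lborel"
  obtains \<mu> :: "real \<Rightarrow> 'a measure" where "\<forall>\<epsilon>. \<mu> \<epsilon> \<in> Mb" "\<forall>\<^sub>F \<epsilon> in at_right 0. \<mu> \<epsilon> \<in> EM \<epsilon>"
    "tight_tendsto (rescaled \<mu>) M"
proof -
  define P where "P n \<epsilon> M' \<longleftrightarrow> M' \<in> EM \<epsilon> \<and> (\<forall>f B w. f \<in> borel_measurable borel \<longrightarrow> (\<forall>x. \<bar>f x\<bar> \<le> B) \<longrightarrow>
    (\<forall>x y. dist x y \<le> 1 / real (Suc n) \<longrightarrow> \<bar>f x - f y\<bar> \<le> w) \<longrightarrow>
    \<bar>(\<integral>x. f x \<partial>scale_measure (ennreal (atom_mass TYPE('a) \<epsilon>)) M') - (\<integral>x. f x \<partial>M)\<bar>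
      \<le> 2 * w * measure M UNIV + B * (1 / real (Suc n)))" for n \<epsilon> and M' :: "'a measure"
  have "\<forall>\<^sub>F \<epsilon> in at_right 0. \<exists>M'. P n \<epsilon> M'" for n
    using packing_approximation[OF M, of "1 / real (Suc n)"] unfolding P_def by (simp add: Bex_def)
  moreover have "P n \<epsilon> M'" if p: "P (Suc n) \<epsilon> M'" for n \<epsilon> M'
    unfolding P_def
  proof (intro conjI allI impI)
    show "M' \<in> EM \<epsilon>" using p by (simp add: P_def)
    fix f :: "'a \<Rightarrow> real" and B w
    assume f: "f \<in> borel_measurable borel" "\<forall>x. \<bar>f x\<bar> \<le> B"
      "\<forall>x y. dist x y \<le> 1 / real (Suc n) \<longrightarrow> \<bar>f x - f y\<bar> \<le> w"
    have le: "1 / real (Suc (Suc n)) \<le> 1 / real (Suc n)" by (simp add: field_simps)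
    then have "\<forall>x y. dist x y \<le> 1 / real (Suc (Suc n)) \<longrightarrow> \<bar>f x - f y\<bar> \<le> w" using f(3) order_trans by blast
    then have "\<bar>(\<integral>x. f x \<partial>scale_measure (ennreal (atom_mass TYPE('a) \<epsilon>)) M') - (\<integral>x. f x \<partial>M)\<bar>
      \<le> 2 * w * measure M UNIV + B * (1 / real (Suc (Suc n)))"
      using p f(1,2) unfolding P_def by blast
    also have "B * (1 / real (Suc (Suc n))) \<le> B * (1 / real (Suc n))"
      using le f(2)[rule_format, of 0] by (intro mult_left_mono) linarith+
    finally show "\<bar>(\<integral>x. f x \<partial>scale_measure (ennreal (atom_mass TYPE('a) \<epsilon>)) M') - (\<integral>x. f x \<partial>M)\<bar>
      \<le> 2 * w * measure M UNIV + B * (1 / real (Suc n))" by simp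
  qed
  ultimately obtain S where S: "\<forall>n. \<forall>\<^sub>F \<epsilon> in at_right 0. P n \<epsilon> (S \<epsilon>)"
    by (rule diagonal_choice[of P])
  define \<mu> where "\<mu> \<epsilon> = (if S \<epsilon> \<in> EM \<epsilon> then S \<epsilon> else dirac_sum 0 (\<lambda>_. 0))" for \<epsilon>
  have Mb: "\<mu> \<epsilon> \<in> Mb" for \<epsilon>
    unfolding \<mu>_def EM_def using dirac_sum_Mb by auto
  have ev: "\<forall>\<^sub>F \<epsilon> in at_right 0. P n \<epsilon> (\<mu> \<epsilon>)" for n
    using S[rule_format, of n] by eventually_elim (simp add: \<mu>_def P_def)
  have EM: "\<forall>\<^sub>F \<epsilon> in at_right 0. \<mu> \<epsilon> \<in> EM \<epsilon>"
    using ev[of 0] by eventually_elim (simp add: P_def)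
  have m0: "0 \<le> measure M UNIV" by simp
  have conv: "((\<lambda>\<epsilon>. \<integral>x. f x \<partial>rescaled \<mu> \<epsilon>) \<longlongrightarrow> (\<integral>x. f x \<partial>M)) (at_right 0)"
    if f: "f \<in> borel_measurable borel" "\<And>x. \<bar>f x\<bar> \<le> B"
      and uc: "\<And>e. 0 < e \<Longrightarrow> \<exists>d>0. \<forall>x y. dist x y < d \<longrightarrow> \<bar>f x - f y\<bar> < e" for f :: "'a \<Rightarrow> real" and B
  proof (rule tendstoI)
    fix e :: real assume e: "0 < e"
    define w where "w = e / (4 * (measure M UNIV + 1))"
    have w: "0 < w" "2 * w * measure M UNIV \<le> e / 2"
    proof -
      have t: "0 < measure M UNIV + 1" using m0 by linarith
      then show "0 < w" using e unfolding w_def by (intro divide_pos_pos mult_pos_pos) auto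
      then have "2 * w * measure M UNIV \<le> 2 * w * (measure M UNIV + 1)" by (intro mult_left_mono) auto
      also have "\<dots> = e / 2" using t unfolding w_def by (simp add: field_split_simps)
      finally show "2 * w * measure M UNIV \<le> e / 2" .
    qed
    obtain d where d: "0 < d" "\<And>x y. dist x y < d \<Longrightarrow> \<bar>f x - f y\<bar> < w" using uc[OF w(1)] by blast
    have "(\<lambda>n. 1 / real (Suc n)) \<longlonglongrightarrow> 0" using LIMSEQ_inverse_real_of_nat unfolding inverse_eq_divide .
    from tendsto_mult_left[OF this, of B] this
    have "\<forall>\<^sub>F n in sequentially. B * (1 / real (Suc n)) < e / 2" "\<forall>\<^sub>F n in sequentially. 1 / real (Suc n) < d"
      using e d(1) by (elim order_tendstoD(2); simp)+
    then have "\<forall>\<^sub>F n in sequentially. B * (1 / real (Suc n)) < e / 2 \<and> 1 / real (Suc n) < d" by eventually_elim simp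
    then obtain n where n: "B * (1 / real (Suc n)) < e / 2" "1 / real (Suc n) < d"
      using eventually_happens' by force
    have w': "\<forall>x y. dist x y \<le> 1 / real (Suc n) \<longrightarrow> \<bar>f x - f y\<bar> \<le> w" using d(2) n(2) by (meson le_less_trans less_imp_le)
    show "\<forall>\<^sub>F \<epsilon> in at_right 0. dist (\<integral>x. f x \<partial>rescaled \<mu> \<epsilon>) (\<integral>x. f x \<partial>M) < e"
      using ev[of n]
    proof eventually_elim
      case (elim \<epsilon>)
      then have "\<bar>(\<integral>x. f x \<partial>rescaled \<mu> \<epsilon>) - (\<integral>x. f x \<partial>M)\<bar> \<le> 2 * w * measure M UNIV + B * (1 / real (Suc n))"
        unfolding P_def rescaled_def using f w' by blast
      then show ?case using w(2) n(1) unfolding dist_real_def by linarith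
    qed
  qed
  have "weak_star_tendsto (rescaled \<mu>) M"
    unfolding weak_star_tendsto_def
  proof (intro allI impI)
    fix f :: "'a \<Rightarrow> real" assume f: "continuous_on UNIV f" "(f \<longlongrightarrow> 0) at_infinity"
    obtain B where "\<And>x. \<bar>f x\<bar> \<le> B" using vanishing_at_infinity_bounded[OF f] by blast
    then show "((\<lambda>\<epsilon>. \<integral>x. f x \<partial>rescaled \<mu> \<epsilon>) \<longlongrightarrow> (\<integral>x. f x \<partial>M)) (at_right 0)"
    proof (rule conv[OF borel_measurable_continuous_onI[OF f(1)]])
      show "\<exists>d>0. \<forall>x y. dist x y < d \<longrightarrow> \<bar>f x - f y\<bar> < e" if "0 < e" for e
        using vanishing_at_infinity_uniformly_continuous[OF f that] by metis
    qed
  qed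
  moreover have "((\<lambda>\<epsilon>. measure (rescaled \<mu> \<epsilon>) UNIV) \<longlongrightarrow> measure M UNIV) (at_right 0)"
  proof -
    have "((\<lambda>\<epsilon>. \<integral>x. (1::real) \<partial>rescaled \<mu> \<epsilon>) \<longlongrightarrow> (\<integral>x. 1 \<partial>M)) (at_right 0)"
      by (rule conv[where B=1]) (auto intro: exI[of _ 1])
    moreover have "rescaled \<mu> \<epsilon> \<in> Mb" for \<epsilon> unfolding rescaled_def by (rule scale_measure_Mb[OF Mb])
    ultimately show ?thesis using M(1) by (simp only: Mb_integral_const mult_1)
  qed
  ultimately have "tight_tendsto (rescaled \<mu>) M" unfolding tight_tendsto_def by blast
  with Mb EM show ?thesis using that by blast
qed

theorem theorem3p3:
  fixes \<sigma> :: real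
  assumes "- real DIM('a::euclidean_space) < \<sigma>" and "\<sigma> < 0"
  shows
    "(\<forall>\<rho> \<in> (L1_unit :: ('a \<Rightarrow> real) set). \<forall>\<mu> :: real \<Rightarrow> 'a measure.
        (\<forall>\<epsilon>\<in>{0<..<1}. \<mu> \<epsilon> \<in> Mb) \<longrightarrow>
        tight_tendsto (rescaled \<mu>) (with_density \<rho>) \<longrightarrow>
        limit_energy \<sigma> (with_density \<rho>)
          \<le> Liminf (at_right 0) (\<lambda>\<epsilon>. discrete_energy \<sigma> \<epsilon> (\<mu> \<epsilon>))) \<and>
     (\<forall>\<rho> \<in> (L1_unit :: ('a \<Rightarrow> real) set). \<exists>\<mu> :: real \<Rightarrow> 'a measure.
        (\<forall>\<epsilon>\<in>{0<..<1}. \<mu> \<epsilon> \<in> Mb) \<and>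
        tight_tendsto (rescaled \<mu>) (with_density \<rho>) \<and>
        limit_energy \<sigma> (with_density \<rho>)
          \<ge> Limsup (at_right 0) (\<lambda>\<epsilon>. discrete_energy \<sigma> \<epsilon> (\<mu> \<epsilon>)))"
proof (intro conjI ballI allI impI)
  fix \<rho> :: "'a \<Rightarrow> real" and \<mu> :: "real \<Rightarrow> 'a measure"
  assume "\<rho> \<in> L1_unit" "\<forall>\<epsilon>\<in>{0<..<1}. \<mu> \<epsilon> \<in> Mb" "tight_tendsto (rescaled \<mu>) (with_density \<rho>)"
  then show "limit_energy \<sigma> (with_density \<rho>) \<le> Liminf (at_right 0) (\<lambda>\<epsilon>. discrete_energy \<sigma> \<epsilon> (\<mu> \<epsilon>))"
    by (rule discrete_energy_liminf[OF assms])
next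
  fix \<rho> :: "'a \<Rightarrow> real" assume \<rho>: "\<rho> \<in> L1_unit"
  obtain \<mu> :: "real \<Rightarrow> 'a measure" where \<mu>: "\<forall>\<epsilon>. \<mu> \<epsilon> \<in> Mb" "\<forall>\<^sub>F \<epsilon> in at_right 0. \<mu> \<epsilon> \<in> EM \<epsilon>"
    "tight_tendsto (rescaled \<mu>) (with_density \<rho>)"
    by (rule recovery_family[OF with_density_Mb[OF \<rho>] with_density_le_lborel[OF \<rho>]])
  have "Limsup (at_right 0) (\<lambda>\<epsilon>. discrete_energy \<sigma> \<epsilon> (\<mu> \<epsilon>)) \<le> limit_energy \<sigma> (with_density \<rho>)"
    using discrete_energy_limsup[OF assms(1) \<rho> _ \<mu>(3,2)] \<mu>(1) by blast
  with \<mu> show "\<exists>\<mu>. (\<forall>\<epsilon>\<in>{0<..<1}. \<mu> \<epsilon> \<in> Mb) \<and> tight_tendsto (rescaled \<mu>) (with_density \<rho>) \<and>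
      Limsup (at_right 0) (\<lambda>\<epsilon>. discrete_energy \<sigma> \<epsilon> (\<mu> \<epsilon>)) \<le> limit_energy \<sigma> (with_density \<rho>)"
    by blast
qed

end
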